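(* Let $\alpha\in(\frac12,1)$. Consider the fractional Hegselmann--Krause optimal control problem with leadership: minimize $$\mathcal J(x,u)=\int_0^T f(t,x(t),u(t))\,dt$$ subject to $$\begin{cases}D^{\alpha}_{0+}[x_0](t)=u(t),\\ D^{\alpha}_{0+}[x_i](t)=\sum_{j=1}^N a_{ij}(x_j(t)-x_i(t))+c_i(x_0(t)-x_i(t)),\quad i=1,\dots,N,\end{cases}\qquad\text{for a.e. }t\in[0,T],$$ $$I^{1-\alpha}_{0+}[x_j](0)=x_{j0},\quad j=0,1,\dots,N,\qquad u(t)\in M,\ t\in[0,T],$$ where $$f(t,x,u)=\frac{1}{2N^2}\sum_{i,j=1}^N\|x_i-x_j\|^2+\frac12\sum_{i=1}^N\|x_0-x_i\|^2+\frac{\nu}{2}\|u\|^2 .$$ If $$(x_*,u_* )\in\left(I^{\alpha}_{0+}\bigl(L^2([0,T];(\mathbb R^d)^{N+1})\bigr)+\left\{\frac{c}{t^{1-\alpha}}:c\in(\mathbb R^d)^{N+1}\right\}\right)\times\mathcal U_M$$ is a locally optimal solution to this problem, then there exists a function $\lambda\in I^{\alpha}_{T-}\bigl(L^2([0,T];(\mathbb R^d)^{N+1})\bigr)$ such that $$D^{\alpha}_{T-}[\lambda](t)=A^T\lambda(t)+\frac{\partial f}{\partial x}(t,x_*(t),u_*(t))\quad\text{for a.e. }t\in[0,T],\qquad I^{1-\alpha}_{T-}[\lambda](T)=0,$$ where $$\frac{\partial f}{\partial x}(t,x,u)=\begin{bmatrix}Nx_0-\sum_{i=1}^Nx_i\\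 \frac2N\bigl(x_1-\frac1N\sum_{j=1}^Nx_j\bigr)+(x_1-x_0)\\ \vdots\\ \frac2N\bigl(x_N-\frac1N\sum_{j=1}^Nx_j\bigr)+(x_N-x_0)\end{bmatrix}.$$ Furthermore, for a.e. $t\in[0,T]$, $$f(t,x_*(t),u_*(t))+\lambda(t)\cdot g(t,x_*(t),u_*(t))=\min_{u\in M}\bigl\{f(t,x_*(t),u)+\lambda(t)\cdot g(t,x_*(t),u)\bigr\},$$ where $g(t,x,u)\in(\mathbb R^d)^{N+1}$ has components $g_0=u$ and $g_i=\sum_{j=1}^Na_{ij}(x_j-x_i)+c_i(x_0-x_i)$, $i=1,\dots,N$.
   Context: Data: $T>0$, integers $d\ge1$ and $N>1$, constants $a_{ij}\ge0$ and $c_i\ge0$ ($i,j=1,\dots,N$), $\nu>0$, $K\geq 0$, and initial data $x_{j0}\in\mathbb R^d$ ($j=0,\dots,N$). $\|\cdot\|$ is the Euclidean norm and $\cdot$ the Euclidean inner product. The state is $x=(x_0,x_1,\dots,x_N):[0,T]\to(\mathbb R^d)^{N+1}$ ($x_0$ is the leader, $x_1,\dots,x_N$ are the agents). The control takes values in $M=\{v\in\mathbb R^d:\|v\|\le K\}$, and $\mathcal U_M=\{u\in L^1([0,T];\mathbb R^d):u(t)\in M,\ t\in[0,T]\}$. $A$ is the $(N+1)\times(N+1)$ block matrix with $d\times d$ blocks, rows and columns indexed by $0,\dots,N$: row $0$ is zero; for $i\ge1$ the block $(i,0)$ is $c_iI_d$, the block $(i,i)$ is $s_iI_d$ with $s_i=-\bigl(\sum_{j\ne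 i}a_{ij}+c_i\bigr)$ (sum over $j\in\{1,\dots,N\}$, $j\neq i$), and the block $(i,j)$ is $a_{ij}I_d$ for $j\ge1$, $j\ne i$. Here $I_d$ is the identity matrix. Riemann--Liouville fractional integrals of order $\beta>0$ of $h\in L^1([0,T];\mathbb R^n)$, for a.e. $t\in[0,T]$: $$I^{\beta}_{0+}[h](t)=\frac1{\Gamma(\beta)}\int_0^t\frac{h(\tau)}{(t-\tau)^{1-\beta}}\,d\tau,\qquad I^{\beta}_{T-}[h](t)=\frac1{\Gamma(\beta)}\int_t^T\frac{h(\tau)}{(\tau-t)^{1-\beta}}\,d\tau .$$ $I^{\alpha}_{0+}(L^2)$ and $I^{\alpha}_{T-}(L^2)$ denote the sets of functions of the form $I^\alpha_{0+}[\varphi]$, respectively $I^\alpha_{T-}[\varphi]$, with $\varphi\in L^2$. For $\alpha\in(0,1)$, the Riemann--Liouville derivatives are $D^{\alpha}_{0+}[h]=\frac{d}{dt}I^{1-\alpha}_{0+}[h]$ and $D^{\alpha}_{T-}[h]=-\frac{d}{dt}I^{1-\alpha}_{T-}[h]$ a.e., defined when $I^{1-\alpha}_{0+}[h]$, respectively $I^{1-\alpha}_{T-}[h]$, is absolutely continuous (has an absolutely continuous representative); the values $I^{1-\alpha}_{0+}[h](0)$ and $I^{1-\alpha}_{T-}[h](T)$ are those of the absolutely continuous representatives. Let $X=I^{\alpha}_{0+}(L^2([0,T];(\mathbb R^d)^{N+1}))+\{c/t^{1-\alpha}:c\in(\mathbb R^d)^{N+1}\}$, normed by $\|x\|_X=|I^{1-\alpha}_{0+}[x](0)|+\|D^{\alpha}_{0+}[x]\|_{L^2}$.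 A pair $(x_*,u_* )\in X\times\mathcal U_M$ is a locally optimal solution if it satisfies the system a.e. and the initial conditions, and there is a neighborhood $V$ of $x_*$ in $X$ such that $\mathcal J(x_*,u_* )\le\mathcal J(x,u)$ for every pair $(x,u)\in V\times\mathcal U_M$ satisfying the system a.e. and the initial conditions. *)

theory Defs
  imports "HOL-Analysis.Analysis"
begin

text \<open>
  Elements of the Lebesgue spaces are represented by functions on the reals of which only the
  values on the interval matter; equality of elements is equality almost everywhere.
\<close>

definition L1_on :: "real \<Rightarrow> (real \<Rightarrow> 'a::euclidean_space) \<Rightarrow> bool" where
  "L1_on T h \<longleftrightarrow> integrable (lebesgue_on {0..T}) h"

definition L2_on :: "real \<Rightarrow> (real \<Rightarrow> 'a::euclidean_space) \<Rightarrow> bool" where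
  "L2_on T h \<longleftrightarrow> h \<in> borel_measurable (lebesgue_on {0..T}) \<and>
     integrable (lebesgue_on {0..T}) (\<lambda>t. (norm (h t))\<^sup>2)"

definition L2_norm_on :: "real \<Rightarrow> (real \<Rightarrow> 'a::euclidean_space) \<Rightarrow> real" where
  "L2_norm_on T h = sqrt (LINT t|lebesgue_on {0..T}. (norm (h t))\<^sup>2)"

text \<open>
  Absolute continuity of a function on a compact interval (the library has absolute continuity
  of measures only): finite sets of pairwise non-overlapping subintervals are given as
  finite sets of pairs of end points.
\<close>

definition abs_cont_on :: "real \<Rightarrow> real \<Rightarrow> (real \<Rightarrow> 'a::real_normed_vector) \<Rightarrow> bool" where
  "abs_cont_on a b F \<longleftrightarrow>
     (\<forall>\<epsilon>>0. \<exists>\<delta>>0. \<forall>P. finite P \<and> (\<forall>(s, t)\<in>P. a \<le> s \<and> s \<le> t \<and> t \<le> b) \<and>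
        disjoint_family_on (\<lambda>(s, t). {s<..<t}) P \<and> (\<Sum>(s, t)\<in>P. t - s) < \<delta>
        \<longrightarrow> (\<Sum>(s, t)\<in>P. norm (F t - F s)) < \<epsilon>)"

definition is_ac_rep :: "real \<Rightarrow> (real \<Rightarrow> 'a::euclidean_space) \<Rightarrow> (real \<Rightarrow> 'a) \<Rightarrow> bool" where
  "is_ac_rep T h F \<longleftrightarrow> abs_cont_on 0 T F \<and> (AE t in lebesgue_on {0..T}. F t = h t)"

text \<open>
  For \<open>T > 0\<close> the absolutely continuous representative, if it exists, is unique on \<open>{0..T}\<close>,
  so the choice below is immaterial there.
\<close>

definition ac_rep :: "real \<Rightarrow> (real \<Rightarrow> 'a::euclidean_space) \<Rightarrow> real \<Rightarrow> 'a" where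
  "ac_rep T h = (SOME F. is_ac_rep T h F)"

text \<open>
  At \<open>\<tau> = t\<close> the kernel takes the value 0. For integrable \<open>h\<close> the integrands are
  integrable for almost every \<open>t\<close>, and the values at the other points are irrelevant.
\<close>

definition RL_int_left :: "real \<Rightarrow> (real \<Rightarrow> 'a::euclidean_space) \<Rightarrow> real \<Rightarrow> 'a" where
  "RL_int_left \<beta> h t =
     (1 / Gamma \<beta>) *\<^sub>R (LINT \<tau>|lebesgue_on {0..t}. h \<tau> /\<^sub>R (t - \<tau>) powr (1 - \<beta>))"

definition RL_int_right :: "real \<Rightarrow> real \<Rightarrow> (real \<Rightarrow> 'a::euclidean_space) \<Rightarrow> real \<Rightarrow> 'a" where
  "RL_int_right T \<beta> h t =
     (1 / Gamma \<beta>) *\<^sub>R (LINT \<tau>|lebesgue_on {t..T}. h \<tau> /\<^sub>R (\<tau> - t) powr (1 - \<beta>))"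

definition RL_int_left_L2 :: "real \<Rightarrow> real \<Rightarrow> (real \<Rightarrow> 'a::euclidean_space) set" where
  "RL_int_left_L2 T \<alpha> =
     {h. \<exists>\<phi>. L2_on T \<phi> \<and> (AE t in lebesgue_on {0..T}. h t = RL_int_left \<alpha> \<phi> t)}"

definition RL_int_right_L2 :: "real \<Rightarrow> real \<Rightarrow> (real \<Rightarrow> 'a::euclidean_space) set" where
  "RL_int_right_L2 T \<alpha> =
     {h. \<exists>\<phi>. L2_on T \<phi> \<and> (AE t in lebesgue_on {0..T}. h t = RL_int_right T \<alpha> \<phi> t)}"

definition RL_differentiable_left :: "real \<Rightarrow> real \<Rightarrow> (real \<Rightarrow> 'a::euclidean_space) \<Rightarrow> bool" where
  "RL_differentiable_left T \<alpha> h \<longleftrightarrow>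
     L1_on T h \<and> (\<exists>F. is_ac_rep T (RL_int_left (1 - \<alpha>) h) F)"

definition RL_differentiable_right :: "real \<Rightarrow> real \<Rightarrow> (real \<Rightarrow> 'a::euclidean_space) \<Rightarrow> bool" where
  "RL_differentiable_right T \<alpha> h \<longleftrightarrow>
     L1_on T h \<and> (\<exists>F. is_ac_rep T (RL_int_right T (1 - \<alpha>) h) F)"

text \<open>
  The derivatives and boundary values are meaningful only under the two predicates above; the
  classical derivative of the absolutely continuous representative exists almost everywhere.
\<close>

definition RL_deriv_left :: "real \<Rightarrow> real \<Rightarrow> (real \<Rightarrow> 'a::euclidean_space) \<Rightarrow> real \<Rightarrow> 'a" where
  "RL_deriv_left T \<alpha> h t =
     vector_derivative (ac_rep T (RL_int_left (1 - \<alpha>) h)) (at t within {0..T})"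

definition RL_deriv_right :: "real \<Rightarrow> real \<Rightarrow> (real \<Rightarrow> 'a::euclidean_space) \<Rightarrow> real \<Rightarrow> 'a" where
  "RL_deriv_right T \<alpha> h t =
     - vector_derivative (ac_rep T (RL_int_right T (1 - \<alpha>) h)) (at t within {0..T})"

definition RL_initial_value :: "real \<Rightarrow> real \<Rightarrow> (real \<Rightarrow> 'a::euclidean_space) \<Rightarrow> 'a" where
  "RL_initial_value T \<alpha> h = ac_rep T (RL_int_left (1 - \<alpha>) h) 0"

definition RL_terminal_value :: "real \<Rightarrow> real \<Rightarrow> (real \<Rightarrow> 'a::euclidean_space) \<Rightarrow> 'a" where
  "RL_terminal_value T \<alpha> h = ac_rep T (RL_int_right T (1 - \<alpha>) h) T"

definition X_space :: "real \<Rightarrow> real \<Rightarrow> (real \<Rightarrow> 'a::euclidean_space) set" where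
  "X_space T \<alpha> =
     {x. \<exists>y c. y \<in> RL_int_left_L2 T \<alpha> \<and>
           (AE t in lebesgue_on {0..T}. x t = y t + c /\<^sub>R t powr (1 - \<alpha>))}"

definition X_norm :: "real \<Rightarrow> real \<Rightarrow> (real \<Rightarrow> 'a::euclidean_space) \<Rightarrow> real" where
  "X_norm T \<alpha> x = norm (RL_initial_value T \<alpha> x) + L2_norm_on T (RL_deriv_left T \<alpha> x)"

definition X_nbhd :: "real \<Rightarrow> real \<Rightarrow> (real \<Rightarrow> 'a::euclidean_space) \<Rightarrow> (real \<Rightarrow> 'a) set \<Rightarrow> bool" where
  "X_nbhd T \<alpha> x V \<longleftrightarrow> V \<subseteq> X_space T \<alpha> \<and>
     (\<exists>\<epsilon>>0. {y \<in> X_space T \<alpha>. X_norm T \<alpha> (\<lambda>t. y t - x t) < \<epsilon>} \<subseteq> V)"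

text \<open>
  The agents are indexed by a finite type \<open>'n\<close>, so \<open>N = CARD('n)\<close>. The state is indexed by
  \<open>'n option\<close>: \<open>None\<close> is the leader (index 0) and \<open>Some i\<close> is agent \<open>i\<close>.
\<close>

type_synonym ('d, 'n) state = "(real ^ 'd) ^ ('n option)"

type_synonym ('d, 'n) block_matrix = "((real ^ 'd) ^ 'd) ^ ('n option) ^ ('n option)"

definition control_values :: "real \<Rightarrow> (real ^ 'd::finite) set" where
  "control_values K = {v. norm v \<le> K}"

definition controls :: "real \<Rightarrow> real \<Rightarrow> (real \<Rightarrow> real ^ 'd::finite) set" where
  "controls T K = {u. L1_on T u \<and> (\<forall>t\<in>{0..T}. u t \<in> control_values K)}"

definition dynamics ::
  "('n \<Rightarrow> 'n \<Rightarrow> real) \<Rightarrow> ('n \<Rightarrow> real) \<Rightarrow> ('d::finite, 'n::finite) state \<Rightarrow> real ^ 'd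
     \<Rightarrow> ('d, 'n) state" where
  "dynamics a c x u = (\<chi> k. case k of
       None \<Rightarrow> u
     | Some i \<Rightarrow> (\<Sum>j\<in>UNIV. a i j *\<^sub>R (x $ Some j - x $ Some i)) + c i *\<^sub>R (x $ None - x $ Some i))"

definition system_matrix ::
  "('n \<Rightarrow> 'n \<Rightarrow> real) \<Rightarrow> ('n \<Rightarrow> real) \<Rightarrow> ('d::finite, 'n::finite) block_matrix" where
  "system_matrix a c = (\<chi> k l. case k of
       None \<Rightarrow> 0
     | Some i \<Rightarrow> (case l of
           None \<Rightarrow> mat (c i)
         | Some j \<Rightarrow> if j = i then mat (- ((\<Sum>m\<in>UNIV - {i}. a i m) + c i)) else mat (a i j)))"

definition block_transpose :: "('d::finite, 'n::finite) block_matrix \<Rightarrow> ('d, 'n) block_matrix" where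
  "block_transpose B = (\<chi> k l. transpose (B $ l $ k))"

definition block_mult_vec ::
  "('d::finite, 'n::finite) block_matrix \<Rightarrow> ('d, 'n) state \<Rightarrow> ('d, 'n) state" where
  "block_mult_vec B x = (\<chi> k. \<Sum>l\<in>UNIV. B $ k $ l *v x $ l)"

definition running_cost :: "real \<Rightarrow> ('d::finite, 'n::finite) state \<Rightarrow> real ^ 'd \<Rightarrow> real" where
  "running_cost \<nu> x u =
     1 / (2 * (real CARD('n))\<^sup>2) * (\<Sum>i\<in>UNIV. \<Sum>j\<in>UNIV. (norm (x $ Some i - x $ Some j))\<^sup>2)
     + 1 / 2 * (\<Sum>i\<in>UNIV. (norm (x $ None - x $ Some i))\<^sup>2)
     + \<nu> / 2 * (norm u)\<^sup>2"

definition running_cost_grad :: "('d::finite, 'n::finite) state \<Rightarrow> ('d, 'n) state" where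
  "running_cost_grad x = (\<chi> k. case k of
       None \<Rightarrow> real CARD('n) *\<^sub>R x $ None - (\<Sum>i\<in>UNIV. x $ Some i)
     | Some i \<Rightarrow>
         (2 / real CARD('n)) *\<^sub>R (x $ Some i - (1 / real CARD('n)) *\<^sub>R (\<Sum>j\<in>UNIV. x $ Some j))
         + (x $ Some i - x $ None))"

definition total_cost ::
  "real \<Rightarrow> real \<Rightarrow> (real \<Rightarrow> ('d::finite, 'n::finite) state) \<Rightarrow> (real \<Rightarrow> real ^ 'd) \<Rightarrow> real" where
  "total_cost T \<nu> x u = (LINT t|lebesgue_on {0..T}. running_cost \<nu> (x t) (u t))"

definition satisfies_system ::
  "real \<Rightarrow> real \<Rightarrow> ('n \<Rightarrow> 'n \<Rightarrow> real) \<Rightarrow> ('n \<Rightarrow> real) \<Rightarrow> ('d, 'n) state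
     \<Rightarrow> (real \<Rightarrow> ('d::finite, 'n::finite) state) \<Rightarrow> (real \<Rightarrow> real ^ 'd) \<Rightarrow> bool" where
  "satisfies_system T \<alpha> a c x0 x u \<longleftrightarrow>
     (\<forall>k. RL_differentiable_left T \<alpha> (\<lambda>s. x s $ k)) \<and>
     (AE t in lebesgue_on {0..T}.
        \<forall>k. RL_deriv_left T \<alpha> (\<lambda>s. x s $ k) t = dynamics a c (x t) (u t) $ k) \<and>
     (\<forall>k. RL_initial_value T \<alpha> (\<lambda>s. x s $ k) = x0 $ k)"

definition locally_optimal ::
  "real \<Rightarrow> real \<Rightarrow> real \<Rightarrow> real \<Rightarrow> ('n \<Rightarrow> 'n \<Rightarrow> real) \<Rightarrow> ('n \<Rightarrow> real) \<Rightarrow> ('d, 'n) state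
     \<Rightarrow> (real \<Rightarrow> ('d::finite, 'n::finite) state) \<Rightarrow> (real \<Rightarrow> real ^ 'd) \<Rightarrow> bool" where
  "locally_optimal T \<alpha> \<nu> K a c x0 xs us \<longleftrightarrow>
     xs \<in> X_space T \<alpha> \<and> us \<in> controls T K \<and> satisfies_system T \<alpha> a c x0 xs us \<and>
     (\<exists>V. X_nbhd T \<alpha> xs V \<and>
        (\<forall>x\<in>V. \<forall>u\<in>controls T K. satisfies_system T \<alpha> a c x0 x u
            \<longrightarrow> total_cost T \<nu> xs us \<le> total_cost T \<nu> x u))"

definition is_minimum :: "real \<Rightarrow> real set \<Rightarrow> bool" where
  "is_minimum m S \<longleftrightarrow> m \<in> S \<and> (\<forall>s\<in>S. m \<le> s)"

end

theory Submission
  imports Defs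
begin

text \<open>
  The system is linear, the running cost is quadratic and the set of controls is convex, so the
  needle variations of the general theory are replaced by \<open>u + s (v - u)\<close>: the state becomes
  \<open>x + s y\<close>, where \<open>y\<close> solves the linearised equation with zero initial value, and the cost is a
  quadratic polynomial in \<open>s\<close> whose linear coefficient must be nonnegative. Fractional integration
  by parts against the solution \<open>\<lambda>\<close> of the adjoint equation turns that coefficient into
  \<open>\<integral> (\<lambda>\<^sub>0 + \<nu> u) \<bullet> (v - u)\<close>. Choosing \<open>v\<close> to be the pointwise minimiser over the ball gives
  the minimum condition. Both linear equations are Volterra equations
  \<open>g = F + A I\<^sup>\<alpha> g\<close>; since \<open>\<alpha> > 1/2\<close>, \<open>I\<^sup>\<alpha>\<close> maps \<open>L\<^sup>2\<close> to bounded functions, and the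
  Neumann series converges uniformly.
\<close>

section \<open>Borel representatives and the fractional kernel\<close>

text \<open>The notions of the theorem live on \<open>lebesgue_on {0..T}\<close> and identify
  functions up to null sets, whereas Fubini and affine substitution are used for Borel functions and
  \<open>lborel\<close>. Hence every L^2 function is replaced by a Borel representative that
  vanishes off [0,T], and every state by two data, its fractional derivative and the coefficient of
  its singular part; the X-norm and the system become plain statements about these data. Local
  optimality is enough because the X-distance between x + s y and x is s times a constant, and
  convexity of M keeps the varied control admissible for s <= 1. The weight \<lambda>_0 + \<nu> u is
  the gradient in u of the Hamiltonian at the optimal control. What the variation yields is
  therefore only a first-order condition, at almost every t; since \<nu> > 0, the Hamiltonian is
  convex in u and this condition is already the minimum.\<close>

lemma AE_lebesgue_on_iff:
  fixes P :: "real \<Rightarrow> bool"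
  shows "(AE t in lebesgue_on {a..b}. P t) \<longleftrightarrow> (AE t in lebesgue. t \<in> {a..b} \<longrightarrow> P t)"
  by (subst AE_restrict_space_iff) auto

lemma AE_lebesgue_on_of_lborel:
  fixes P :: "real \<Rightarrow> bool"
  assumes "AE t in lborel. t \<in> {a..b} \<longrightarrow> P t"
  shows "AE t in lebesgue_on {a..b}. P t"
  unfolding AE_lebesgue_on_iff using assms by (rule AE_completion)

lemma borel_measurable_lebesgue_on:
  fixes g :: "real \<Rightarrow> 'a::euclidean_space"
  assumes "g \<in> borel_measurable borel"
  shows "g \<in> borel_measurable (lebesgue_on S)"
  using assms by (auto intro!: measurable_restrict_space1 measurable_completion)

text \<open>Lebesgue measure is complete, so changing a function on a null set keeps it measurable.
  Extension by zero moves the question from the interval to the whole line and back.\<close>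

lemma borel_measurable_lebesgue_on_AE:
  fixes f g :: "real \<Rightarrow> 'a::euclidean_space"
  assumes f: "f \<in> borel_measurable (lebesgue_on {a..b})"
    and ae: "AE t in lebesgue_on {a..b}. g t = f t"
  shows "g \<in> borel_measurable (lebesgue_on {a..b})"
proof -
  have "(\<lambda>t. if t \<in> {a..b} then f t else 0) \<in> borel_measurable lebesgue"
    using f by (rule borel_measurable_if_I) simp
  then have "(\<lambda>t. if t \<in> {a..b} then g t else 0) \<in> borel_measurable lebesgue"
    by (rule borel_measurable_AE) (use ae[unfolded AE_lebesgue_on_iff] in \<open>eventually_elim, auto\<close>)
  then show ?thesis by (rule borel_measurable_if_D)
qed

lemma lebesgue_integral_on_Icc:
  fixes f :: "real \<Rightarrow> 'a::euclidean_space"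
  shows "(LINT t|lebesgue_on {a..b}. f t) = (LINT t|lebesgue. indicator {a..b} t *\<^sub>R f t)"
  by (subst integral_restrict_space) auto

lemma integrable_lebesgue_on_Icc:
  fixes f :: "real \<Rightarrow> 'a::euclidean_space"
  shows "integrable (lebesgue_on {a..b}) f \<longleftrightarrow> integrable lebesgue (\<lambda>t. indicator {a..b} t *\<^sub>R f t)"
  by (subst integrable_restrict_space) auto

lemma lebesgue_on_borel_integral:
  fixes f :: "real \<Rightarrow> 'a::euclidean_space"
  assumes [measurable]: "f \<in> borel_measurable borel"
  shows "(LINT t|lebesgue_on {a..b}. f t) = (LINT t|lborel. indicator {a..b} t *\<^sub>R f t)"
  unfolding lebesgue_integral_on_Icc by (rule integral_completion) measurable

lemma lebesgue_on_borel_integrable: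
  fixes f :: "real \<Rightarrow> 'a::euclidean_space"
  assumes [measurable]: "f \<in> borel_measurable borel"
  shows "integrable (lebesgue_on {a..b}) f \<longleftrightarrow> integrable lborel (\<lambda>t. indicator {a..b} t *\<^sub>R f t)"
  unfolding integrable_lebesgue_on_Icc by (rule integrable_completion) measurable

text \<open>A function measurable for the completion agrees almost everywhere with a Borel function;
  this is applied to each coordinate and the coordinates are reassembled over \<open>Basis\<close>.
  The indicator factor forces the zero values off the interval.\<close>

lemma lebesgue_on_borel_rep:
  fixes f :: "real \<Rightarrow> 'a::euclidean_space"
  assumes f: "f \<in> borel_measurable (lebesgue_on {a..b})"
  obtains g where "g \<in> borel_measurable borel" "\<And>t. t \<notin> {a..b} \<Longrightarrow> g t = 0"
    "AE t in lebesgue_on {a..b}. f t = g t"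
proof -
  let ?f = "\<lambda>t. if t \<in> {a..b} then f t else 0"
  have f': "?f \<in> borel_measurable lebesgue"
    using f by (rule borel_measurable_if_I) simp
  have "\<exists>h\<in>borel_measurable lborel. AE x in lborel. ?f x \<bullet> i = h x" for i
    by (rule completion_ex_borel_measurable_real) (use f' in measurable)
  then obtain h where h: "\<And>i. h i \<in> borel_measurable lborel"
      "\<And>i. AE x in lborel. ?f x \<bullet> i = h i x" by metis
  have [measurable]: "\<And>i. h i \<in> borel_measurable borel" using h(1) by simp
  define g where "g = (\<lambda>t. indicator {a..b} t *\<^sub>R (\<Sum>i\<in>Basis. h i t *\<^sub>R i))"
  show ?thesis
  proof
    show "g \<in> borel_measurable borel" unfolding g_def by measurable
    show "g t = 0" if "t \<notin> {a..b}" for t using that by (simp add: g_def)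
    have "AE t in lborel. \<forall>i\<in>Basis. ?f t \<bullet> i = h i t"
      using h(2) by (intro AE_finite_allI) auto
    then have "AE t in lborel. t \<in> {a..b} \<longrightarrow> f t = g t"
    proof eventually_elim
      case (elim t)
      show ?case
      proof
        assume t: "t \<in> {a..b}"
        then have "f t = (\<Sum>i\<in>Basis. (f t \<bullet> i) *\<^sub>R i)" by (simp add: euclidean_representation)
        also have "\<dots> = g t" using elim t by (simp add: g_def)
        finally show "f t = g t" .
      qed
    qed
    then show "AE t in lebesgue_on {a..b}. f t = g t" by (rule AE_lebesgue_on_of_lborel)
  qed
qed

section \<open>Square-integrable Borel representatives\<close>

text \<open>The zero values off [0,T] let integrals over the interval be written as integrals over
  the line, so that convolution, Fubini and reflection need no bookkeeping of domains.\<close>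

definition borel_L2 :: "real \<Rightarrow> (real \<Rightarrow> 'a::euclidean_space) \<Rightarrow> bool" where
  "borel_L2 T g \<longleftrightarrow> g \<in> borel_measurable borel \<and> (\<forall>t. t \<notin> {0..T} \<longrightarrow> g t = 0) \<and>
     integrable lborel (\<lambda>t. (norm (g t))\<^sup>2)"

lemma borel_L2_measurable: "borel_L2 T g \<Longrightarrow> g \<in> borel_measurable borel"
  by (simp add: borel_L2_def)

lemma borel_L2_support: "borel_L2 T g \<Longrightarrow> t \<notin> {0..T} \<Longrightarrow> g t = 0"
  by (simp add: borel_L2_def)

lemma borel_L2_square: "borel_L2 T g \<Longrightarrow> integrable lborel (\<lambda>t. (norm (g t))\<^sup>2)"
  by (simp add: borel_L2_def)

lemma norm_le_square: "norm (x::'a::real_normed_vector) \<le> 1 + (norm x)\<^sup>2"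
proof -
  have "0 \<le> (norm x - 1)\<^sup>2" by simp
  then have "2 * norm x \<le> 1 + (norm x)\<^sup>2" by (simp add: power2_eq_square algebra_simps)
  then show ?thesis using norm_ge_zero[of x] by linarith
qed

lemma integrable_indicator_Icc: "integrable lborel (\<lambda>t::real. indicator {a..b} t :: real)"
  by (simp add: emeasure_lborel_Icc_eq)

text \<open>The interval has finite length, so L^2 embeds in L^1: the constant 1 in
  \<open>norm_le_square\<close> is needed only where \<open>g\<close> may be nonzero.\<close>

lemma borel_L2_integrable:
  assumes "borel_L2 T g"
  shows "integrable lborel g"
proof (rule Bochner_Integration.integrable_bound)
  show "integrable lborel (\<lambda>t. indicator {0..T} t + (norm (g t))\<^sup>2)"
    using borel_L2_square[OF assms] integrable_indicator_Icc by (intro Bochner_Integration.integrable_add)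
  show "AE t in lborel. norm (g t) \<le> norm (indicator {0..T} t + (norm (g t))\<^sup>2)"
    using norm_le_square[of "g _"] borel_L2_support[OF assms]
    by (intro AE_I2) (auto simp: indicator_def)
qed (use borel_L2_measurable[OF assms] in simp)

lemma borel_L2_bounded:
  fixes g :: "real \<Rightarrow> 'a::euclidean_space"
  assumes [measurable]: "g \<in> borel_measurable borel" and "\<And>t. t \<notin> {0..T} \<Longrightarrow> g t = 0" "\<And>t. t \<in> {0..T} \<Longrightarrow> norm (g t) \<le> B"
  shows "borel_L2 T g"
  unfolding borel_L2_def
proof (intro conjI allI impI)
  show "integrable lborel (\<lambda>t. (norm (g t))\<^sup>2)"
  proof (rule Bochner_Integration.integrable_bound)
    show "integrable lborel (\<lambda>t. B\<^sup>2 * indicator {0..T} t)"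
      using integrable_indicator_Icc by (intro integrable_mult_right)
    show "AE t in lborel. norm ((norm (g t))\<^sup>2) \<le> norm (B\<^sup>2 * indicator {0..T} t)"
      using assms(2,3) by (intro AE_I2) (auto simp: indicator_def intro!: power_mono)
  qed measurable
qed (use assms in auto)

lemma norm_add_square_le: "(norm (x + y))\<^sup>2 \<le> 2 * (norm x)\<^sup>2 + 2 * (norm (y::'a::real_inner))\<^sup>2"
proof -
  have "(norm (x + y))\<^sup>2 \<le> (norm (x + y))\<^sup>2 + (norm (x - y))\<^sup>2" by simp
  also have "\<dots> = 2 * (norm x)\<^sup>2 + 2 * (norm y)\<^sup>2"
    by (simp add: power2_norm_eq_inner algebra_simps inner_commute)
  finally show ?thesis .
qed

lemma borel_L2_add:
  assumes f: "borel_L2 T f" and g: "borel_L2 T g"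
  shows "borel_L2 T (\<lambda>t. f t + g t)"
  unfolding borel_L2_def
proof (intro conjI allI impI)
  note [measurable] = borel_L2_measurable[OF f] borel_L2_measurable[OF g]
  show "(\<lambda>t. f t + g t) \<in> borel_measurable borel" by measurable
  show "f t + g t = 0" if "t \<notin> {0..T}" for t using borel_L2_support[OF f that] borel_L2_support[OF g that] by simp
  show "integrable lborel (\<lambda>t. (norm (f t + g t))\<^sup>2)"
  proof (rule Bochner_Integration.integrable_bound)
    show "integrable lborel (\<lambda>t. 2 * (norm (f t))\<^sup>2 + 2 * (norm (g t))\<^sup>2)"
      using borel_L2_square[OF f] borel_L2_square[OF g] by simp
    show "AE t in lborel. norm ((norm (f t + g t))\<^sup>2) \<le> norm (2 * (norm (f t))\<^sup>2 + 2 * (norm (g t))\<^sup>2)"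
      by (intro AE_I2) (use norm_add_square_le in auto)
  qed measurable
qed

lemma borel_L2_linear:
  fixes A :: "'a::euclidean_space \<Rightarrow> 'b::euclidean_space"
  assumes f: "borel_L2 T f" and A: "bounded_linear A"
  shows "borel_L2 T (\<lambda>t. A (f t))"
  unfolding borel_L2_def
proof (intro conjI allI impI)
  note [measurable] = borel_L2_measurable[OF f] borel_measurable_continuous_onI[OF linear_continuous_on[OF A]]
  show *: "(\<lambda>t. A (f t)) \<in> borel_measurable borel" by measurable
  show "A (f t) = 0" if "t \<notin> {0..T}" for t
    using borel_L2_support[OF f that] linear_simps(3)[OF A] by simp
  obtain B where B: "\<And>x. norm (A x) \<le> norm x * B" using bounded_linear.bounded[OF A] by auto
  show "integrable lborel (\<lambda>t. (norm (A (f t)))\<^sup>2)"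
  proof (rule Bochner_Integration.integrable_bound)
    show "integrable lborel (\<lambda>t. B\<^sup>2 * (norm (f t))\<^sup>2)"
      using borel_L2_square[OF f] by simp
    show "AE t in lborel. norm ((norm (A (f t)))\<^sup>2) \<le> norm (B\<^sup>2 * (norm (f t))\<^sup>2)"
    proof (intro AE_I2)
      fix t
      have "(norm (A (f t)))\<^sup>2 \<le> (norm (f t) * B)\<^sup>2" using B by (intro power_mono) auto
      then show "norm ((norm (A (f t)))\<^sup>2) \<le> norm (B\<^sup>2 * (norm (f t))\<^sup>2)"
        by (simp add: power_mult_distrib mult.commute)
    qed
  qed measurable
qed

lemma borel_L2_rep:
  fixes f :: "real \<Rightarrow> 'a::euclidean_space"
  assumes "L2_on T f"
  obtains g where "borel_L2 T g" "AE t in lebesgue_on {0..T}. f t = g t"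
proof -
  have f: "f \<in> borel_measurable (lebesgue_on {0..T})" "integrable (lebesgue_on {0..T}) (\<lambda>t. (norm (f t))\<^sup>2)"
    using assms by (auto simp: L2_on_def)
  obtain g where g: "g \<in> borel_measurable borel" "\<And>t. t \<notin> {0..T} \<Longrightarrow> g t = 0"
    "AE t in lebesgue_on {0..T}. f t = g t" using lebesgue_on_borel_rep[OF f(1)] by metis
  note [measurable] = f(1) g(1) borel_measurable_lebesgue_on[OF g(1)]
  have "integrable (lebesgue_on {0..T}) (\<lambda>t. (norm (g t))\<^sup>2)"
    by (rule iffD1[OF integrable_cong_AE f(2)]) (use g(3) in auto)
  then have "integrable lborel (\<lambda>t. indicator {0..T} t *\<^sub>R (norm (g t))\<^sup>2)"
    by (subst (asm) lebesgue_on_borel_integrable) auto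
  also have "(\<lambda>t. indicator {0..T} t *\<^sub>R (norm (g t))\<^sup>2) = (\<lambda>t. (norm (g t))\<^sup>2)"
    using g(2) by (auto simp: indicator_def fun_eq_iff)
  finally have "borel_L2 T g" using g(1,2) by (auto simp: borel_L2_def)
  then show ?thesis using g(3) that by blast
qed

lemma borel_L2_imp_L2_on:
  assumes "borel_L2 T g"
  shows "L2_on T g"
proof -
  have [measurable]: "g \<in> borel_measurable borel" using assms borel_L2_measurable by blast
  have "integrable (lebesgue_on {0..T}) (\<lambda>t. (norm (g t))\<^sup>2)"
    by (subst lebesgue_on_borel_integrable) (use borel_L2_square[OF assms] in \<open>auto intro!: integrable_mult_indicator simp del: real_scaleR_def\<close>)
  then show ?thesis by (auto simp: L2_on_def intro: borel_measurable_lebesgue_on)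
qed

lemma L2_on_cong_AE:
  assumes f: "L2_on T f" and ae: "AE t in lebesgue_on {0..T}. g t = f t"
  shows "L2_on T g"
proof -
  have m: "f \<in> borel_measurable (lebesgue_on {0..T})" using f by (simp add: L2_on_def)
  note m' = borel_measurable_lebesgue_on_AE[OF m ae]
  note [measurable] = m m'
  have "integrable (lebesgue_on {0..T}) (\<lambda>t. (norm (g t))\<^sup>2)"
    by (rule iffD2[OF integrable_cong_AE]) (use ae f in \<open>auto simp: L2_on_def\<close>)
  then show ?thesis using m' by (simp add: L2_on_def)
qed

section \<open>The Riemann-Liouville kernel and convolution with it\<close>

text \<open>Extension by zero to s <= 0 builds the upper limit of integration into the kernel: for
  \<open>g\<close> vanishing on the negative axis, convolution over the line is the integral from 0
  to t.\<close>

definition frac_kernel :: "real \<Rightarrow> real \<Rightarrow> real" where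
  "frac_kernel \<beta> s = (if 0 < s then s powr (\<beta> - 1) / Gamma \<beta> else 0)"

definition frac_int :: "real \<Rightarrow> (real \<Rightarrow> 'a::euclidean_space) \<Rightarrow> real \<Rightarrow> 'a" where
  "frac_int \<beta> g t = (LINT \<tau>|lborel. frac_kernel \<beta> (t - \<tau>) *\<^sub>R g \<tau>)"

lemma frac_kernel_measurable[measurable]: "frac_kernel \<beta> \<in> borel_measurable borel"
  unfolding frac_kernel_def by measurable

lemma frac_kernel_nonneg: "0 < \<beta> \<Longrightarrow> 0 \<le> frac_kernel \<beta> s"
  by (auto simp: frac_kernel_def Gamma_real_pos intro!: divide_nonneg_pos)

text \<open>At \<open>t = 0\<close> both sides are 0, by the junk values of \<open>powr\<close> and \<open>inverse\<close>.\<close>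

lemma power_eq_frac_kernel:
  fixes v :: "'a::euclidean_space"
  assumes "0 < Gamma \<alpha>" "0 \<le> t"
  shows "v /\<^sub>R t powr (1 - \<alpha>) = frac_kernel \<alpha> t *\<^sub>R (Gamma \<alpha> *\<^sub>R v)"
  using assms by (cases "t = 0") (simp_all add: frac_kernel_def powr_minus[symmetric])

lemma frac_int_measurable:
  assumes [measurable]: "g \<in> borel_measurable borel"
  shows "frac_int \<beta> g \<in> borel_measurable borel"
  unfolding frac_int_def by (rule lborel.borel_measurable_lebesgue_integral) measurable

text \<open>The singularity at 0 is integrable for every positive order. The value comes from the
  antiderivative as a gauge integral, and nonnegativity carries it over to the Lebesgue
  integral.\<close>

lemma frac_kernel_has_bochner_integral:
  assumes "0 < \<beta>" "0 \<le> b"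
  shows "has_bochner_integral lborel (\<lambda>s. indicator {..b} s * frac_kernel \<beta> s) (b powr \<beta> / (\<beta> * Gamma \<beta>))"
proof -
  have G: "0 < Gamma \<beta>" using assms by (simp add: Gamma_real_pos)
  have "((\<lambda>x. x powr (\<beta> - 1)) has_integral (b powr (\<beta> - 1 + 1) / (\<beta> - 1 + 1))) {0..b}"
    using assms by (intro has_integral_powr_from_0) auto
  then have "((\<lambda>x. x powr (\<beta> - 1) / Gamma \<beta>) has_integral (b powr \<beta> / (\<beta> * Gamma \<beta>))) {0..b}"
    by (drule_tac has_integral_divide[where c="Gamma \<beta>"]) simp
  then have "(\<integral>\<^sup>+ x. ennreal (indicator {0..b} x * (x powr (\<beta> - 1) / Gamma \<beta>)) \<partial>lborel) = ennreal (b powr \<beta> / (\<beta> * Gamma \<beta>))"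
    using G by (intro nn_integral_has_integral_lebesgue) auto
  also have "(\<lambda>x. indicator {0..b} x * (x powr (\<beta> - 1) / Gamma \<beta>)) = (\<lambda>s. indicator {..b} s * frac_kernel \<beta> s)"
    by (auto simp: fun_eq_iff frac_kernel_def indicator_def)
  finally show ?thesis
    using G assms frac_kernel_nonneg[of \<beta>] by (intro has_bochner_integral_nn_integral) auto
qed

lemma frac_kernel_integrable:
  assumes "0 < \<beta>"
  shows "integrable lborel (\<lambda>s. indicator {..b} s * frac_kernel \<beta> s)"
proof (cases "0 \<le> b")
  case True
  then show ?thesis using frac_kernel_has_bochner_integral[OF assms] by (auto simp: has_bochner_integral_iff)
next
  case False
  then have "(\<lambda>s. indicator {..b} s * frac_kernel \<beta> s) = (\<lambda>s. 0)"
    by (auto simp: frac_kernel_def indicator_def)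
  then show ?thesis by simp
qed

text \<open>Since 2 (\<alpha> - 1) = (2 \<alpha> - 1) - 1, the square is a multiple of the kernel of
  order 2 \<alpha> - 1, and this order is positive exactly when \<alpha> > 1/2.\<close>

lemma frac_kernel_square:
  assumes "1/2 < \<alpha>"
  shows "(frac_kernel \<alpha> s)\<^sup>2 = Gamma (2 * \<alpha> - 1) / (Gamma \<alpha>)\<^sup>2 * frac_kernel (2 * \<alpha> - 1) s"
proof -
  have "Gamma (2 * \<alpha> - 1) > 0" using assms by (simp add: Gamma_real_pos)
  then show ?thesis
    by (auto simp: frac_kernel_def power_divide powr_power algebra_simps)
qed

lemma frac_kernel_square_integrable:
  assumes "1/2 < \<alpha>"
  shows "integrable lborel (\<lambda>s. indicator {..b} s * (frac_kernel \<alpha> s)\<^sup>2)"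
proof -
  have "integrable lborel (\<lambda>s. (Gamma (2 * \<alpha> - 1) / (Gamma \<alpha>)\<^sup>2) * (indicator {..b} s * frac_kernel (2 * \<alpha> - 1) s))"
    using assms by (intro integrable_mult_right frac_kernel_integrable) auto
  then show ?thesis using assms by (simp add: frac_kernel_square mult_ac)
qed

lemma integrable_reflect_lborel:
  fixes f :: "real \<Rightarrow> 'a::euclidean_space"
  shows "integrable lborel (\<lambda>x. f (t - x)) \<longleftrightarrow> integrable lborel f"
  using lborel_integrable_real_affine_iff[of "-1" f t] by simp

lemma integral_reflect_lborel:
  fixes f :: "real \<Rightarrow> 'a::euclidean_space"
  shows "(LINT x|lborel. f (t - x)) = (LINT x|lborel. f x)"
  using lborel_integral_real_affine[of "-1" f t] by simp

text \<open>Since \<open>\<alpha> > 1/2\<close>, the kernel is locally square integrable; the product is handled by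
  \<open>k * g \<le> k\<^sup>2 + g\<^sup>2\<close>.\<close>

lemma frac_int_integrable:
  assumes a: "1/2 < \<alpha>" and g: "borel_L2 T g"
  shows "integrable lborel (\<lambda>\<tau>. frac_kernel \<alpha> (t - \<tau>) *\<^sub>R g \<tau>)"
    and "(LINT \<tau>|lborel. norm (frac_kernel \<alpha> (t - \<tau>) *\<^sub>R g \<tau>)) \<le>
      (LINT s|lborel. indicator {..t} s * (frac_kernel \<alpha> s)\<^sup>2) + (LINT \<tau>|lborel. (norm (g \<tau>))\<^sup>2)"
proof -
  note [measurable] = borel_L2_measurable[OF g]
  \<comment> \<open>In s = t - \<tau> the cutoff s <= t reads \<tau> >= 0, where \<open>g\<close> is
    supported. It removes the tail of the squared kernel, which need not be integrable at
    infinity.\<close>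
  let ?k = "\<lambda>s. indicator {..t} s * (frac_kernel \<alpha> s)\<^sup>2"
  have ik: "integrable lborel (\<lambda>\<tau>. ?k (t - \<tau>))"
    using frac_kernel_square_integrable[OF a] by (subst integrable_reflect_lborel)
  have bd: "norm (frac_kernel \<alpha> (t - \<tau>) *\<^sub>R g \<tau>) \<le> ?k (t - \<tau>) + (norm (g \<tau>))\<^sup>2" for \<tau>
  proof (cases "\<tau> \<in> {0..T}")
    case True
    have "0 \<le> (frac_kernel \<alpha> (t - \<tau>) - norm (g \<tau>))\<^sup>2" by simp
    then have "2 * (frac_kernel \<alpha> (t - \<tau>) * norm (g \<tau>)) \<le> (frac_kernel \<alpha> (t - \<tau>))\<^sup>2 + (norm (g \<tau>))\<^sup>2"
      by (simp add: power2_eq_square algebra_simps)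
    moreover have "0 \<le> frac_kernel \<alpha> (t - \<tau>)" using a by (intro frac_kernel_nonneg) auto
    moreover from this have "0 \<le> frac_kernel \<alpha> (t - \<tau>) * norm (g \<tau>)" by simp
    ultimately have "frac_kernel \<alpha> (t - \<tau>) * norm (g \<tau>) \<le> (frac_kernel \<alpha> (t - \<tau>))\<^sup>2 + (norm (g \<tau>))\<^sup>2"
      "0 \<le> frac_kernel \<alpha> (t - \<tau>)" by linarith+
    then show ?thesis using True by (simp add: indicator_def)
  qed (use borel_L2_support[OF g] in simp)
  note ib = Bochner_Integration.integrable_add[OF ik borel_L2_square[OF g]]
  show i: "integrable lborel (\<lambda>\<tau>. frac_kernel \<alpha> (t - \<tau>) *\<^sub>R g \<tau>)"
    by (rule Bochner_Integration.integrable_bound[OF ib])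
       (measurable, intro AE_I2 order_trans[OF bd], simp)
  have "(LINT \<tau>|lborel. norm (frac_kernel \<alpha> (t - \<tau>) *\<^sub>R g \<tau>)) \<le> (LINT \<tau>|lborel. ?k (t - \<tau>) + (norm (g \<tau>))\<^sup>2)"
    by (intro integral_mono integrable_norm i ib bd)
  also have "\<dots> = (LINT \<tau>|lborel. ?k (t - \<tau>)) + (LINT \<tau>|lborel. (norm (g \<tau>))\<^sup>2)"
    by (intro Bochner_Integration.integral_add ik borel_L2_square[OF g])
  also have "(LINT \<tau>|lborel. ?k (t - \<tau>)) = (LINT s|lborel. ?k s)"
    by (rule integral_reflect_lborel)
  finally show "(LINT \<tau>|lborel. norm (frac_kernel \<alpha> (t - \<tau>) *\<^sub>R g \<tau>)) \<le>
      (LINT s|lborel. ?k s) + (LINT \<tau>|lborel. (norm (g \<tau>))\<^sup>2)" .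
qed

lemma frac_int_linear:
  fixes L :: "'a::euclidean_space \<Rightarrow> 'b::euclidean_space"
  assumes a: "1/2 < \<alpha>" and g: "borel_L2 T g" and L: "bounded_linear L"
  shows "frac_int \<alpha> (\<lambda>\<tau>. L (g \<tau>)) t = L (frac_int \<alpha> g t)"
proof -
  have "L (frac_int \<alpha> g t) = (LINT \<tau>|lborel. L (frac_kernel \<alpha> (t - \<tau>) *\<^sub>R g \<tau>))"
    unfolding frac_int_def by (rule integral_bounded_linear[OF L frac_int_integrable(1)[OF a g], symmetric])
  then show ?thesis by (simp add: frac_int_def linear_simps(5)[OF L])
qed

lemma frac_int_add:
  assumes a: "1/2 < \<alpha>" and g: "borel_L2 T g" and h: "borel_L2 T h"
  shows "frac_int \<alpha> (\<lambda>\<tau>. g \<tau> + h \<tau>) t = frac_int \<alpha> g t + frac_int \<alpha> h t"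
  unfolding frac_int_def scaleR_add_right
  by (intro Bochner_Integration.integral_add frac_int_integrable(1)[OF a g] frac_int_integrable(1)[OF a h])

text \<open>The integral of the squared kernel up to t grows with t, so its value at T serves for
  all t <= T. The bound with the norm under the integral is the one that Fubini needs.\<close>

lemma frac_int_bounded:
  assumes a: "1/2 < \<alpha>" and g: "borel_L2 T g"
  obtains C where "0 \<le> C"
    "\<And>t. t \<le> T \<Longrightarrow> (LINT \<tau>|lborel. norm (frac_kernel \<alpha> (t - \<tau>) *\<^sub>R g \<tau>)) \<le> C"
    "\<And>t. t \<le> T \<Longrightarrow> norm (frac_int \<alpha> g t) \<le> C"
proof -
  define C where "C = (LINT s|lborel. indicator {..T} s * (frac_kernel \<alpha> s)\<^sup>2) + (LINT \<tau>|lborel. (norm (g \<tau>))\<^sup>2)"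
  have 1: "(LINT \<tau>|lborel. norm (frac_kernel \<alpha> (t - \<tau>) *\<^sub>R g \<tau>)) \<le> C" if "t \<le> T" for t
  proof -
    have "(LINT s|lborel. indicator {..t} s * (frac_kernel \<alpha> s)\<^sup>2) \<le> (LINT s|lborel. indicator {..T} s * (frac_kernel \<alpha> s)\<^sup>2)"
      using that a by (intro integral_mono frac_kernel_square_integrable) (auto simp: indicator_def)
    then show ?thesis using frac_int_integrable(2)[OF a g, of t] unfolding C_def by linarith
  qed
  show ?thesis
  proof
    show "0 \<le> C" unfolding C_def by (intro add_nonneg_nonneg integral_nonneg_AE) auto
    show "norm (frac_int \<alpha> g t) \<le> C" if "t \<le> T" for t
      unfolding frac_int_def by (rule order_trans[OF integral_norm_bound 1[OF that]])
  qed (rule 1)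
qed

text \<open>Zero values of \<open>g\<close> are required only to the left of 0, because the kernel
  removes everything after t. Thus the lemma also covers functions that do not vanish beyond
  T.\<close>

lemma RL_int_left_eq_frac_int:
  fixes f g :: "real \<Rightarrow> 'a::euclidean_space"
  assumes [measurable]: "g \<in> borel_measurable borel" and g0: "\<And>\<tau>. \<tau> \<in> {..t} - {0..t} \<Longrightarrow> g \<tau> = 0"
    and ae: "AE \<tau> in lebesgue_on {0..T}. f \<tau> = g \<tau>" and t: "t \<le> T"
  shows "RL_int_left \<beta> f t = frac_int \<beta> g t"
proof -
  have "(LINT \<tau>|lebesgue_on {0..t}. f \<tau> /\<^sub>R (t - \<tau>) powr (1 - \<beta>)) =
     (LINT \<tau>|lebesgue_on {0..t}. g \<tau> /\<^sub>R (t - \<tau>) powr (1 - \<beta>))"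
  proof (rule integral_cong_AE)
    have ae': "AE \<tau> in lebesgue_on {0..t}. f \<tau> = g \<tau>"
      using ae unfolding AE_lebesgue_on_iff by eventually_elim (use t in auto)
    then have ae'': "AE \<tau> in lebesgue_on {0..t}. f \<tau> /\<^sub>R (t - \<tau>) powr (1 - \<beta>) = g \<tau> /\<^sub>R (t - \<tau>) powr (1 - \<beta>)"
      by eventually_elim simp
    then show "AE \<tau> in lebesgue_on {0..t}. f \<tau> /\<^sub>R (t - \<tau>) powr (1 - \<beta>) = g \<tau> /\<^sub>R (t - \<tau>) powr (1 - \<beta>)" .
    show m: "(\<lambda>\<tau>. g \<tau> /\<^sub>R (t - \<tau>) powr (1 - \<beta>)) \<in> borel_measurable (lebesgue_on {0..t})"
      by (intro borel_measurable_lebesgue_on) measurable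
    show "(\<lambda>\<tau>. f \<tau> /\<^sub>R (t - \<tau>) powr (1 - \<beta>)) \<in> borel_measurable (lebesgue_on {0..t})"
      by (rule borel_measurable_lebesgue_on_AE[OF m ae''])
  qed
  also have "\<dots> = (LINT \<tau>|lborel. indicator {0..t} \<tau> *\<^sub>R (g \<tau> /\<^sub>R (t - \<tau>) powr (1 - \<beta>)))"
    by (rule lebesgue_on_borel_integral) measurable
  finally have "RL_int_left \<beta> f t = (LINT \<tau>|lborel. (1 / Gamma \<beta>) *\<^sub>R (indicator {0..t} \<tau> *\<^sub>R (g \<tau> /\<^sub>R (t - \<tau>) powr (1 - \<beta>))))"
    unfolding RL_int_left_def by (simp only: integral_scaleR_right)
  also have "\<dots> = (LINT \<tau>|lborel. frac_kernel \<beta> (t - \<tau>) *\<^sub>R g \<tau>)"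
  proof (intro Bochner_Integration.integral_cong refl)
    fix \<tau>
    have p: "inverse ((t - \<tau>) powr (1 - \<beta>)) = (t - \<tau>) powr (\<beta> - 1)"
      by (simp add: powr_minus[symmetric])
    show "(1 / Gamma \<beta>) *\<^sub>R (indicator {0..t} \<tau> *\<^sub>R (g \<tau> /\<^sub>R (t - \<tau>) powr (1 - \<beta>))) = frac_kernel \<beta> (t - \<tau>) *\<^sub>R g \<tau>"
    proof (cases "\<tau> \<in> {0..t}")
      case True
      show ?thesis
      \<comment> \<open>At \<open>\<tau> = t\<close> the power \<open>0 powr (1 - \<beta>)\<close>
        is 0 and so is its inverse, in agreement with
        \<open>frac_kernel \<beta> 0 = 0\<close>.\<close>
      proof (cases "\<tau> = t")
        case False
        with True have "0 < t - \<tau>" by simp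
        then have "frac_kernel \<beta> (t - \<tau>) = (t - \<tau>) powr (\<beta> - 1) / Gamma \<beta>"
          unfolding frac_kernel_def by (rule if_P)
        then show ?thesis unfolding p using True by simp
      qed (simp add: frac_kernel_def)
    next
      case False
      then have "frac_kernel \<beta> (t - \<tau>) = 0 \<or> g \<tau> = 0"
        using g0[of \<tau>] by (cases "\<tau> \<le> t") (auto simp: frac_kernel_def)
      then show ?thesis using False by auto
    qed
  qed
  finally show ?thesis unfolding frac_int_def .
qed

section \<open>The semigroup property and Riemann--Liouville derivatives\<close>

text \<open>Prepares the time reversal t -> T - t, which exchanges left-sided and right-sided
  operators: statements that hold almost everywhere must survive it.\<close>

lemma negligible_reflect:
  fixes N :: "real set"
  assumes "negligible N"
  shows "negligible ((\<lambda>x. c - x) ` N)"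
  by (rule negligible_differentiable_image_negligible[OF _ assms]) (auto intro!: derivative_intros)

lemma AE_lebesgue_reflect:
  fixes P :: "real \<Rightarrow> bool"
  assumes "AE t in lebesgue. P t"
  shows "AE t in lebesgue. P (c - t)"
proof -
  obtain N where N: "negligible N" "{x. \<not> P x} \<subseteq> N"
    using assms unfolding eventually_ae_filter_negligible by blast
  have "{t. \<not> P (c - t)} \<subseteq> (\<lambda>x. c - x) ` N"
  proof
    fix t assume "t \<in> {t. \<not> P (c - t)}"
    then have "c - t \<in> N" using N(2) by auto
    then show "t \<in> (\<lambda>x. c - x) ` N" by (intro image_eqI[of _ _ "c - t"]) auto
  qed
  then show ?thesis unfolding eventually_ae_filter_negligible using negligible_reflect[OF N(1)] by blast
qed

lemma AE_lebesgue_on_reflect: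
  fixes P :: "real \<Rightarrow> bool"
  assumes "AE t in lebesgue_on {0..T}. P t"
  shows "AE t in lebesgue_on {0..T}. P (T - t)"
  using AE_lebesgue_reflect[OF assms[unfolded AE_lebesgue_on_iff], of T]
  unfolding AE_lebesgue_on_iff by eventually_elim auto

text \<open>For nonnegative functions the gauge integral is the Lebesgue integral. This imports the
  Beta and Gamma integrals.\<close>

lemma has_integral_imp_has_bochner_integral_lborel:
  fixes f :: "real \<Rightarrow> real"
  assumes [measurable]: "f \<in> borel_measurable borel" "\<Omega> \<in> sets borel"
    and nn: "\<And>x. x \<in> \<Omega> \<Longrightarrow> 0 \<le> f x" and I: "(f has_integral I) \<Omega>"
  shows "has_bochner_integral lborel (\<lambda>x. indicator \<Omega> x * f x) I"
proof (rule has_bochner_integral_nn_integral)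
  show "0 \<le> I" using has_integral_nonneg[OF I] nn by auto
  show "(\<integral>\<^sup>+ x. ennreal (indicator \<Omega> x * f x) \<partial>lborel) = ennreal I"
    using nn I by (intro nn_integral_has_integral_lebesgue)
  show "AE x in lborel. 0 \<le> indicator \<Omega> x * f x" using nn by (auto simp: indicator_def)
qed measurable

text \<open>Euler's Beta integral: the kernels of orders 1 - \<alpha> and \<alpha> convolve to the
  kernel of order 1, a Heaviside function. Substituting s = \<tau> + c x with c = t - \<tau>, all
  powers of c cancel, and Beta(\<alpha>, 1 - \<alpha>) is Gamma(\<alpha>) Gamma(1 -
  \<alpha>).\<close>

lemma frac_kernel_convolution:
  assumes a: "0 < \<alpha>" "\<alpha> < 1"
  shows "has_bochner_integral lborel (\<lambda>s. frac_kernel (1 - \<alpha>) (t - s) * frac_kernel \<alpha> (s - \<tau>))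
    (if \<tau> < t then 1 else 0)"
proof (cases "\<tau> < t")
  case False
  then have "(\<lambda>s. frac_kernel (1 - \<alpha>) (t - s) * frac_kernel \<alpha> (s - \<tau>)) = (\<lambda>s. 0)"
    by (auto simp: fun_eq_iff frac_kernel_def)
  then show ?thesis using False by (simp add: has_bochner_integral_zero)
next
  case True
  define c where "c = t - \<tau>"
  have c: "0 < c" using True by (simp add: c_def)
  have G: "0 < Gamma \<alpha>" "0 < Gamma (1 - \<alpha>)" using a by (auto intro: Gamma_real_pos)
  have "has_bochner_integral lborel (\<lambda>x. indicator {0..1} x * (x powr (\<alpha> - 1) * (1 - x) powr (1 - \<alpha> - 1))) (Beta \<alpha> (1 - \<alpha>))"
    using a by (intro has_integral_imp_has_bochner_integral_lborel has_integral_Beta_real) auto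
  then have "has_bochner_integral lborel
     (\<lambda>x. (indicator {0..1} x * (x powr (\<alpha> - 1) * (1 - x) powr (1 - \<alpha> - 1))) * (1 / (c * Gamma \<alpha> * Gamma (1 - \<alpha>))))
     (Beta \<alpha> (1 - \<alpha>) * (1 / (c * Gamma \<alpha> * Gamma (1 - \<alpha>))))"
    by (intro has_bochner_integral_mult_left)
  also have "(\<lambda>x. (indicator {0..1} x * (x powr (\<alpha> - 1) * (1 - x) powr (1 - \<alpha> - 1))) * (1 / (c * Gamma \<alpha> * Gamma (1 - \<alpha>))))
     = (\<lambda>x. frac_kernel (1 - \<alpha>) (t - (\<tau> + c * x)) * frac_kernel \<alpha> (\<tau> + c * x - \<tau>))"
  proof
    fix x :: real
    have e: "t - (\<tau> + c * x) = c * (1 - x)" "\<tau> + c * x - \<tau> = c * x" by (auto simp: c_def algebra_simps)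
    show "(indicator {0..1} x * (x powr (\<alpha> - 1) * (1 - x) powr (1 - \<alpha> - 1))) * (1 / (c * Gamma \<alpha> * Gamma (1 - \<alpha>)))
      = frac_kernel (1 - \<alpha>) (t - (\<tau> + c * x)) * frac_kernel \<alpha> (\<tau> + c * x - \<tau>)"
    proof (cases "0 < x \<and> x < 1")
      case True
      then have p: "0 < c * x" "0 < c * (1 - x)" using c by auto
      have "c powr (1 - \<alpha> - 1) * c powr (\<alpha> - 1) = c powr (-1)" by (simp add: powr_add[symmetric])
      then have cc: "c powr (1 - \<alpha> - 1) * c powr (\<alpha> - 1) = 1 / c" using c by (simp add: powr_minus_divide)
      have "frac_kernel (1 - \<alpha>) (c * (1 - x)) * frac_kernel \<alpha> (c * x) =
        (c powr (1 - \<alpha> - 1) * c powr (\<alpha> - 1)) * ((1 - x) powr (1 - \<alpha> - 1) * x powr (\<alpha> - 1)) / (Gamma \<alpha> * Gamma (1 - \<alpha>))"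
        using p True c by (simp add: frac_kernel_def powr_mult mult_ac)
      then show ?thesis unfolding e cc using True by (simp add: mult_ac)
    next
      case False
      then have "\<not> 0 < c * x \<or> \<not> 0 < c * (1 - x)" "indicator {0..1} x * (x powr (\<alpha> - 1) * (1 - x) powr (1 - \<alpha> - 1)) = 0"
        using c by (auto simp: zero_less_mult_iff indicator_def)
      then show ?thesis unfolding e by (auto simp: frac_kernel_def)
    qed
  qed
  also have "Beta \<alpha> (1 - \<alpha>) * (1 / (c * Gamma \<alpha> * Gamma (1 - \<alpha>))) = 1 /\<^sub>R \<bar>c\<bar>"
    using G c by (simp add: Beta_def field_simps)
  finally show ?thesis using True c
    by (subst lborel_has_bochner_integral_real_affine_iff[of c _ _ \<tau>]) simp_all
qed

lemma frac_kernel_scaleR_eq_0: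
  assumes "borel_L2 T g" "s \<le> 0"
  shows "frac_kernel \<beta> (s - \<tau>) *\<^sub>R g \<tau> = 0"
  using assms(2) borel_L2_support[OF assms(1), of \<tau>] by (auto simp: frac_kernel_def)

text \<open>Fubini reduces the composition of the two fractional integrals to the convolution of
  their kernels, which leaves an ordinary primitive. The integrability claim serves to split off the
  singular part of a state later.\<close>

lemma frac_int_semigroup:
  assumes a: "1/2 < \<alpha>" "\<alpha> < 1" and g: "borel_L2 T g" and t: "t \<le> T"
  shows "frac_int (1 - \<alpha>) (frac_int \<alpha> g) t = (LINT \<tau>|lborel. indicator {..<t} \<tau> *\<^sub>R g \<tau>)"
    and "integrable lborel (\<lambda>s. frac_kernel (1 - \<alpha>) (t - s) *\<^sub>R frac_int \<alpha> g s)"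
proof -
  note [measurable] = borel_L2_measurable[OF g] frac_int_measurable[OF borel_L2_measurable[OF g]]
  define F where "F = (\<lambda>s \<tau>. frac_kernel (1 - \<alpha>) (t - s) *\<^sub>R (frac_kernel \<alpha> (s - \<tau>) *\<^sub>R g \<tau>))"
  define N where "N = (\<lambda>s. LINT \<tau>|lborel. norm (frac_kernel \<alpha> (s - \<tau>) *\<^sub>R g \<tau>))"
  have [measurable]: "(\<lambda>(s, \<tau>). F s \<tau>) \<in> borel_measurable (lborel \<Otimes>\<^sub>M lborel)"
    unfolding F_def by measurable
  have [measurable]: "N \<in> borel_measurable borel"
    unfolding N_def by (rule lborel.borel_measurable_lebesgue_integral) measurable
  obtain C where C: "0 \<le> C" "\<And>s. s \<le> T \<Longrightarrow> N s \<le> C" "\<And>s. s \<le> T \<Longrightarrow> norm (frac_int \<alpha> g s) \<le> C"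
    using frac_int_bounded[OF a(1) g] unfolding N_def by metis
  have N0: "N s = 0" "frac_int \<alpha> g s = 0" if "s \<le> 0" for s
    unfolding N_def frac_int_def frac_kernel_scaleR_eq_0[OF g that] by simp_all
  have Nn: "0 \<le> N s" for s unfolding N_def by (intro integral_nonneg_AE) auto
  have ik: "integrable lborel (\<lambda>s. C * (indicator {..t} (t - s) * frac_kernel (1 - \<alpha>) (t - s)))"
    using a frac_kernel_integrable[of "1 - \<alpha>" t] integrable_reflect_lborel[of "\<lambda>s. indicator {..t} s * frac_kernel (1 - \<alpha>) s" t]
    by (intro integrable_mult_right) simp
  have k0: "0 \<le> frac_kernel (1 - \<alpha>) s" for s using a by (intro frac_kernel_nonneg) auto
  \<comment> \<open>Stated for an arbitrary \<open>h\<close> because it is needed twice: for the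
    vector-valued \<open>frac_int \<alpha> g\<close> and for the real function \<open>N\<close>.
    Both are bounded by \<open>C\<close> up to T and vanish for s <= 0.\<close>
  have dom: "norm (frac_kernel (1 - \<alpha>) (t - s) *\<^sub>R h s) \<le> norm (C * (indicator {..t} (t - s) * frac_kernel (1 - \<alpha>) (t - s)))"
    if h: "\<And>s. s \<le> T \<Longrightarrow> norm (h s) \<le> C" "\<And>s. s \<le> 0 \<Longrightarrow> h s = 0" for h :: "real \<Rightarrow> 'b::real_normed_vector" and s
  proof (cases "0 < s \<and> s < t")
    case True
    then have "norm (h s) \<le> C" using h(1)[of s] t by auto
    then have "frac_kernel (1 - \<alpha>) (t - s) * norm (h s) \<le> frac_kernel (1 - \<alpha>) (t - s) * C"
      using k0 by (intro mult_left_mono) auto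
    then show ?thesis using True k0[of "t - s"] C(1) by (simp add: mult_ac abs_mult)
  next
    case False
    then have "frac_kernel (1 - \<alpha>) (t - s) = 0 \<or> h s = 0" using h(2)[of s] by (auto simp: frac_kernel_def not_less)
    then show ?thesis by auto
  qed
  show "integrable lborel (\<lambda>s. frac_kernel (1 - \<alpha>) (t - s) *\<^sub>R frac_int \<alpha> g s)"
    by (rule Bochner_Integration.integrable_bound[OF ik]) (measurable, intro AE_I2 dom C N0)
  have intF: "integrable (lborel \<Otimes>\<^sub>M lborel) (\<lambda>(s, \<tau>). F s \<tau>)"
  proof (rule lborel_pair.Fubini_integrable)
    have "(\<lambda>s. LINT \<tau>|lborel. norm (case (s, \<tau>) of (s, \<tau>) \<Rightarrow> F s \<tau>)) = (\<lambda>s. frac_kernel (1 - \<alpha>) (t - s) *\<^sub>R N s)"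
      using k0 by (simp add: F_def N_def mult.assoc abs_mult)
    moreover have "integrable lborel (\<lambda>s. frac_kernel (1 - \<alpha>) (t - s) *\<^sub>R N s)"
      by (rule Bochner_Integration.integrable_bound[OF ik]) (measurable, intro AE_I2 dom, use C N0 Nn in auto)
    ultimately show "integrable lborel (\<lambda>s. LINT \<tau>|lborel. norm (case (s, \<tau>) of (s, \<tau>) \<Rightarrow> F s \<tau>))" by simp
    show "AE s in lborel. integrable lborel (\<lambda>\<tau>. case (s, \<tau>) of (s, \<tau>) \<Rightarrow> F s \<tau>)"
      unfolding F_def using frac_int_integrable(1)[OF a(1) g]
      by (intro AE_I2) (simp del: scaleR_scaleR)
  qed measurable
  have "frac_int (1 - \<alpha>) (frac_int \<alpha> g) t = (LINT s|lborel. LINT \<tau>|lborel. F s \<tau>)"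
    by (simp add: frac_int_def F_def del: scaleR_scaleR)
  also have "\<dots> = (LINT \<tau>|lborel. LINT s|lborel. F s \<tau>)"
    by (rule lborel_pair.Fubini_integral[OF intF, symmetric])
  also have "\<dots> = (LINT \<tau>|lborel. indicator {..<t} \<tau> *\<^sub>R g \<tau>)"
  proof (intro Bochner_Integration.integral_cong refl)
    fix \<tau>
    have "(LINT s|lborel. F s \<tau>) = (LINT s|lborel. (frac_kernel (1 - \<alpha>) (t - s) * frac_kernel \<alpha> (s - \<tau>)) *\<^sub>R g \<tau>)"
      by (simp add: F_def)
    also have "\<dots> = (if \<tau> < t then 1 else 0) *\<^sub>R g \<tau>"
      using frac_kernel_convolution[of \<alpha> t \<tau>] a
      by (subst integral_scaleR_left) (auto simp: has_bochner_integral_iff)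
    finally show "(LINT s|lborel. F s \<tau>) = indicator {..<t} \<tau> *\<^sub>R g \<tau>" by simp
  qed
  finally show "frac_int (1 - \<alpha>) (frac_int \<alpha> g) t = (LINT \<tau>|lborel. indicator {..<t} \<tau> *\<^sub>R g \<tau>)" .
qed

section \<open>Absolutely continuous representatives and their derivatives\<close>

text \<open>With |g| <= M + |g|^2 / M, the variation over disjoint intervals is at most M times
  their total length plus Q / M, where Q is the integral of |g|^2. A large M controls the second
  term, then a short length controls the first.\<close>

lemma abs_cont_on_primitive:
  fixes g :: "real \<Rightarrow> 'a::euclidean_space"
  assumes g: "borel_L2 T g"
  shows "abs_cont_on 0 T (\<lambda>t. v + (LINT \<tau>|lborel. indicator {..<t} \<tau> *\<^sub>R g \<tau>))"
  unfolding abs_cont_on_def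
proof (intro allI impI)
  fix \<epsilon> :: real assume e: "0 < \<epsilon>"
  note [measurable] = borel_L2_measurable[OF g]
  let ?F = "\<lambda>t. v + (LINT \<tau>|lborel. indicator {..<t} \<tau> *\<^sub>R g \<tau>)"
  define Q where "Q = (LINT \<tau>|lborel. (norm (g \<tau>))\<^sup>2)"
  have Q: "0 \<le> Q" unfolding Q_def by (intro integral_nonneg_AE) auto
  \<comment> \<open>Chosen so that Q / M stays below \<epsilon> / 2; the summand 1 keeps M positive
    when Q = 0.\<close>
  define M where "M = 2 * Q / \<epsilon> + 1"
  have M: "0 < M" "Q / M < \<epsilon> / 2" using Q e by (auto simp: M_def field_simps add_pos_nonneg)
  define \<delta> where "\<delta> = \<epsilon> / (2 * M)"
  have d: "0 < \<delta>" "M * \<delta> = \<epsilon> / 2" using e M by (auto simp: \<delta>_def)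
  have AM: "norm (g \<tau>) \<le> M + (norm (g \<tau>))\<^sup>2 / M" for \<tau>
  proof -
    have "0 \<le> (M - norm (g \<tau>))\<^sup>2" by simp
    then have "2 * (M * norm (g \<tau>)) \<le> M * M + (norm (g \<tau>))\<^sup>2"
      by (simp add: power2_eq_square algebra_simps)
    moreover have "0 \<le> M * norm (g \<tau>)" using M by simp
    ultimately have "M * norm (g \<tau>) \<le> M * M + (norm (g \<tau>))\<^sup>2" by linarith
    then show ?thesis using M by (simp add: field_simps)
  qed
  have ing: "integrable lborel (\<lambda>\<tau>. indicator A \<tau> *\<^sub>R g \<tau>)" if [measurable]: "A \<in> sets borel" for A
    using borel_L2_integrable[OF g] by (intro integrable_mult_indicator) auto
  have inq: "integrable lborel (\<lambda>\<tau>. indicator A \<tau> * (norm (g \<tau>))\<^sup>2)" if [measurable]: "A \<in> sets borel" for A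
    using integrable_mult_indicator[OF _ borel_L2_square[OF g], of A] by simp
  have inc: "integrable lborel (\<lambda>\<tau>. M * indicator {s<..<t} \<tau>)" for s t :: real
    by (intro integrable_mult_right, cases "s \<le> t") simp_all
  have step: "norm (?F t - ?F s) \<le> M * (t - s) + (LINT \<tau>|lborel. indicator {s<..<t} \<tau> * (norm (g \<tau>))\<^sup>2) / M"
    if st: "s \<le> t" for s t
  proof -
    have "?F t - ?F s = (LINT \<tau>|lborel. indicator {..<t} \<tau> *\<^sub>R g \<tau> - indicator {..<s} \<tau> *\<^sub>R g \<tau>)"
      by (subst Bochner_Integration.integral_diff) (auto intro: ing)
    also have "\<dots> = (LINT \<tau>|lborel. indicator {s<..<t} \<tau> *\<^sub>R g \<tau>)"
    \<comment> \<open>The difference of the indicators is that of the half-open interval [s,t). Its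
      end point s is dropped as a null set, to match the open intervals in
      \<open>abs_cont_on\<close>.\<close>
    proof (rule integral_cong_AE)
      show "AE \<tau> in lborel. indicator {..<t} \<tau> *\<^sub>R g \<tau> - indicator {..<s} \<tau> *\<^sub>R g \<tau> = indicator {s<..<t} \<tau> *\<^sub>R g \<tau>"
        using AE_lborel_singleton[of s] by eventually_elim (use st in \<open>auto simp: indicator_def\<close>)
    qed measurable
    finally have "norm (?F t - ?F s) \<le> (LINT \<tau>|lborel. norm (indicator {s<..<t} \<tau> *\<^sub>R g \<tau>))"
      using integral_norm_bound by metis
    also have "\<dots> \<le> (LINT \<tau>|lborel. M * indicator {s<..<t} \<tau> + indicator {s<..<t} \<tau> * (norm (g \<tau>))\<^sup>2 / M)"
      using AM M by (intro integral_mono Bochner_Integration.integrable_add inc integrable_divide inq integrable_norm ing)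
        (auto simp: indicator_def)
    also have "\<dots> = (LINT \<tau>|lborel. M * indicator {s<..<t} \<tau>) + (LINT \<tau>|lborel. indicator {s<..<t} \<tau> * (norm (g \<tau>))\<^sup>2 / M)"
      by (intro Bochner_Integration.integral_add inc integrable_divide inq) auto
    also have "(LINT \<tau>|lborel. M * indicator {s<..<t} \<tau>) = M * (t - s)"
      using st by simp
    finally show ?thesis by simp
  qed
  show "\<exists>\<delta>>0. \<forall>P. finite P \<and> (\<forall>(s, t)\<in>P. 0 \<le> s \<and> s \<le> t \<and> t \<le> T) \<and>
        disjoint_family_on (\<lambda>(s, t). {s<..<t}) P \<and> (\<Sum>(s, t)\<in>P. t - s) < \<delta>
        \<longrightarrow> (\<Sum>(s, t)\<in>P. norm (?F t - ?F s)) < \<epsilon>"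
  proof (intro exI[of _ \<delta>] conjI allI impI, rule d)
    fix P :: "(real \<times> real) set"
    assume "finite P \<and> (\<forall>(s, t)\<in>P. 0 \<le> s \<and> s \<le> t \<and> t \<le> T) \<and>
        disjoint_family_on (\<lambda>(s, t). {s<..<t}) P \<and> (\<Sum>(s, t)\<in>P. t - s) < \<delta>"
    then have P: "finite P" "\<And>s t. (s, t) \<in> P \<Longrightarrow> s \<le> t"
      "disjoint_family_on (\<lambda>(s, t). {s<..<t}) P" "(\<Sum>(s, t)\<in>P. t - s) < \<delta>" by auto
    let ?A = "\<lambda>(s, t). {s<..<t}"
    have "(\<Sum>(s, t)\<in>P. norm (?F t - ?F s)) \<le> (\<Sum>p\<in>P. M * (snd p - fst p) + (LINT \<tau>|lborel. indicator (?A p) \<tau> * (norm (g \<tau>))\<^sup>2) / M)"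
      by (intro sum_mono) (use step P(2) in \<open>auto simp: split_beta\<close>)
    also have "\<dots> = M * (\<Sum>(s, t)\<in>P. t - s) + (\<Sum>p\<in>P. (LINT \<tau>|lborel. indicator (?A p) \<tau> * (norm (g \<tau>))\<^sup>2)) / M"
      by (simp add: sum.distrib sum_distrib_left sum_divide_distrib split_beta)
    also have "(\<Sum>p\<in>P. (LINT \<tau>|lborel. indicator (?A p) \<tau> * (norm (g \<tau>))\<^sup>2)) =
        (LINT \<tau>|lborel. (\<Sum>p\<in>P. indicator (?A p) \<tau> * (norm (g \<tau>))\<^sup>2))"
      by (rule Bochner_Integration.integral_sum[symmetric]) (auto intro!: inq)
    also have "\<dots> \<le> Q" unfolding Q_def
    proof (rule integral_mono)
      show "integrable lborel (\<lambda>\<tau>. \<Sum>p\<in>P. indicator (?A p) \<tau> * (norm (g \<tau>))\<^sup>2)"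
        by (intro Bochner_Integration.integrable_sum) (auto intro!: inq)
      show "integrable lborel (\<lambda>\<tau>. (norm (g \<tau>))\<^sup>2)" by (rule borel_L2_square[OF g])
      fix \<tau>
      \<comment> \<open>By disjointness the indicators add up to the indicator of a union, so the
        bound Q does not depend on the number of intervals.\<close>
      have "(\<Sum>p\<in>P. indicator (?A p) \<tau> * (norm (g \<tau>))\<^sup>2) = indicator (\<Union> (?A ` P)) \<tau> * (norm (g \<tau>))\<^sup>2"
        by (simp add: sum_distrib_right[symmetric] indicator_UN_disjoint[OF P(1,3)])
      also have "\<dots> \<le> (norm (g \<tau>))\<^sup>2" by (auto simp: indicator_def)
      finally show "(\<Sum>p\<in>P. indicator (?A p) \<tau> * (norm (g \<tau>))\<^sup>2) \<le> (norm (g \<tau>))\<^sup>2" .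
    qed
    finally have "(\<Sum>(s, t)\<in>P. norm (?F t - ?F s)) \<le> M * (\<Sum>(s, t)\<in>P. t - s) + Q / M"
      using M by (simp add: divide_right_mono)
    also have "\<dots> < M * \<delta> + \<epsilon> / 2" using P(4) M by (intro add_strict_mono) auto
    finally show "(\<Sum>(s, t)\<in>P. norm (?F t - ?F s)) < \<epsilon>" using d by simp
  qed
qed

text \<open>Families consisting of a single interval already give uniform continuity.\<close>

lemma abs_cont_on_modulus:
  assumes F: "abs_cont_on a b F" and e: "0 < \<epsilon>"
  obtains \<delta> where "0 < \<delta>" "\<And>s t. s \<in> {a..b} \<Longrightarrow> t \<in> {a..b} \<Longrightarrow> \<bar>t - s\<bar> < \<delta> \<Longrightarrow> norm (F t - F s) < \<epsilon>"
proof -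
  obtain \<delta> where d: "0 < \<delta> \<and> (\<forall>P. finite P \<and> (\<forall>(s, t)\<in>P. a \<le> s \<and> s \<le> t \<and> t \<le> b) \<and>
        disjoint_family_on (\<lambda>(s, t). {s<..<t}) P \<and> (\<Sum>(s, t)\<in>P. t - s) < \<delta>
        \<longrightarrow> (\<Sum>(s, t)\<in>P. norm (F t - F s)) < \<epsilon>)"
    using F[unfolded abs_cont_on_def, THEN spec, THEN mp, OF e] ..
  have *: "norm (F t - F s) < \<epsilon>" if "a \<le> s" "s \<le> t" "t \<le> b" "t - s < \<delta>" for s t
    using conjunct2[OF d, THEN spec, of "{(s, t)}"] that by (simp add: disjoint_family_on_def)
  show ?thesis
  proof (rule that)
    show "0 < \<delta>" using d ..
    fix s t assume "s \<in> {a..b}" "t \<in> {a..b}" "\<bar>t - s\<bar> < \<delta>"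
    then show "norm (F t - F s) < \<epsilon>"
      using *[of s t] *[of t s] by (cases "s \<le> t") (auto simp: norm_minus_commute)
  qed
qed

text \<open>A null set contains no interval, so arbitrarily close to t there is a point where both
  functions agree; continuity transports the equality to t, also at the end points.\<close>

lemma abs_cont_on_AE_unique:
  fixes F G :: "real \<Rightarrow> 'a::euclidean_space"
  assumes F: "abs_cont_on a b F" and G: "abs_cont_on a b G" and ab: "a < b"
    and ae: "AE t in lebesgue_on {a..b}. F t = G t" and t: "t \<in> {a..b}"
  shows "F t = G t"
proof (rule ccontr)
  assume "F t \<noteq> G t"
  then have e: "0 < norm (F t - G t) / 2" by simp
  obtain d1 where d1: "0 < d1" "\<And>s t'. s \<in> {a..b} \<Longrightarrow> t' \<in> {a..b} \<Longrightarrow> \<bar>t' - s\<bar> < d1 \<Longrightarrow> norm (F t' - F s) < norm (F t - G t) / 2"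
    using abs_cont_on_modulus[OF F e] by blast
  obtain d2 where d2: "0 < d2" "\<And>s t'. s \<in> {a..b} \<Longrightarrow> t' \<in> {a..b} \<Longrightarrow> \<bar>t' - s\<bar> < d2 \<Longrightarrow> norm (G t' - G s) < norm (F t - G t) / 2"
    using abs_cont_on_modulus[OF G e] by blast
  obtain N where N: "negligible N" "{x. \<not> (x \<in> {a..b} \<longrightarrow> F x = G x)} \<subseteq> N"
    using ae unfolding AE_lebesgue_on_iff eventually_ae_filter_negligible by blast
  \<comment> \<open>Clipping at a and b leaves a one-sided neighbourhood when t is an end point; it
    is nondegenerate because a < b.\<close>
  define l r where "l = max a (t - min d1 d2)" and "r = min b (t + min d1 d2)"
  have "l < r" using t ab d1(1) d2(1) by (auto simp: l_def r_def)
  then have "\<not> {l<..<r} \<subseteq> N"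
    using negligible_subset[OF N(1)] negligible_interval(2)[of l r] by (auto simp: box_real)
  then obtain s where s: "s \<in> {l<..<r}" "s \<notin> N" by blast
  then have s': "s \<in> {a..b}" "\<bar>t - s\<bar> < d1" "\<bar>t - s\<bar> < d2" by (auto simp: l_def r_def abs_if)
  have "F s = G s" using N(2) s(2) s'(1) by blast
  then have "F t - G t = (F t - F s) - (G t - G s)" by simp
  then have "norm (F t - G t) \<le> norm (F t - F s) + norm (G t - G s)" by (metis norm_triangle_ineq4)
  also have "\<dots> < norm (F t - G t)" using d1(2)[OF s'(1) t s'(2)] d2(2)[OF s'(1) t s'(3)] by simp
  finally show False by simp
qed

text \<open>Eliminates the choice operator: any explicit representative may be evaluated instead, in
  particular at 0 and T, where the boundary values are taken.\<close>

lemma ac_rep_eq: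
  fixes F h :: "real \<Rightarrow> 'a::euclidean_space"
  assumes F: "is_ac_rep T h F" and T: "0 < T" and t: "t \<in> {0..T}"
  shows "ac_rep T h t = F t"
proof -
  have R: "is_ac_rep T h (ac_rep T h)" unfolding ac_rep_def by (rule someI[of _ F]) (rule F)
  have "AE t in lebesgue_on {0..T}. ac_rep T h t = F t"
    using conjunct2[OF R[unfolded is_ac_rep_def]] conjunct2[OF F[unfolded is_ac_rep_def]]
    by eventually_elim simp
  then show ?thesis using R F T t unfolding is_ac_rep_def by (intro abs_cont_on_AE_unique[of 0 T]) auto
qed

text \<open>Passes to the gauge integral, in whose terms the differentiation theorem is stated. The
  half-open interval of the left side and the closed one differ by the null set {t}.\<close>

lemma integral_Icc_primitive:
  fixes g :: "real \<Rightarrow> 'a::euclidean_space"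
  assumes g: "integrable lborel g" and st: "s \<le> t"
  shows "integral {s..t} g = (LINT \<tau>|lborel. indicator {..<t} \<tau> *\<^sub>R g \<tau>) - (LINT \<tau>|lborel. indicator {..<s} \<tau> *\<^sub>R g \<tau>)"
proof -
  note [measurable] = borel_measurable_integrable[OF g]
  have ing: "integrable lborel (\<lambda>\<tau>. indicator A \<tau> *\<^sub>R g \<tau>)" if [measurable]: "A \<in> sets borel" for A
    using g by (intro integrable_mult_indicator) auto
  have "(LINT \<tau>|lborel. indicator {..<t} \<tau> *\<^sub>R g \<tau>) - (LINT \<tau>|lborel. indicator {..<s} \<tau> *\<^sub>R g \<tau>)
     = (LINT \<tau>|lborel. indicator {..<t} \<tau> *\<^sub>R g \<tau> - indicator {..<s} \<tau> *\<^sub>R g \<tau>)"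
    by (subst Bochner_Integration.integral_diff) (auto intro: ing)
  also have "\<dots> = (LINT \<tau>|lborel. indicator {s..t} \<tau> *\<^sub>R g \<tau>)"
  proof (rule integral_cong_AE)
    show "AE \<tau> in lborel. indicator {..<t} \<tau> *\<^sub>R g \<tau> - indicator {..<s} \<tau> *\<^sub>R g \<tau> = indicator {s..t} \<tau> *\<^sub>R g \<tau>"
      using AE_lborel_singleton[of t] by eventually_elim (use st in \<open>auto simp: indicator_def\<close>)
  qed measurable
  also have "\<dots> = integral {s..t} g"
  proof -
    have "((\<lambda>\<tau>. indicator {s..t} \<tau> *\<^sub>R g \<tau>) has_integral (LINT \<tau>|lborel. indicator {s..t} \<tau> *\<^sub>R g \<tau>)) UNIV"
      by (intro has_integral_integral_lborel ing) auto
    moreover have "(\<lambda>\<tau>. indicator {s..t} \<tau> *\<^sub>R g \<tau>) = (\<lambda>\<tau>. if \<tau> \<in> {s..t} then g \<tau> else 0)"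
      by (auto simp: indicator_def)
    ultimately have "(g has_integral (LINT \<tau>|lborel. indicator {s..t} \<tau> *\<^sub>R g \<tau>)) {s..t}"
      using has_integral_restrict_UNIV[of "{s..t}" g] by simp
    then show ?thesis by (simp add: integral_unique)
  qed
  finally show ?thesis by simp
qed

text \<open>The library differentiates indefinite integrals to the right only; the left derivative is
  obtained by reflection.\<close>

lemma primitive_has_vector_derivative_AE:
  fixes g :: "real \<Rightarrow> 'a::euclidean_space"
  assumes g: "integrable lborel g"
  shows "AE t in lebesgue. ((\<lambda>t. LINT \<tau>|lborel. indicator {..<t} \<tau> *\<^sub>R g \<tau>) has_vector_derivative g t) (at t)"
proof -
  let ?F = "\<lambda>t. LINT \<tau>|lborel. indicator {..<t} \<tau> *\<^sub>R g \<tau>"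
  have ig: "f integrable_on cbox a b" if "integrable lborel f" for f :: "real \<Rightarrow> 'a" and a b
    using has_integral_integral_lborel[OF that] integrable_on_subcbox
    unfolding integrable_on_def by blast
  have gm: "integrable lborel (\<lambda>x. g (- x))" using integrable_reflect_lborel[of g 0] g by simp
  obtain N1 where N1: "negligible N1" "\<And>x e. x \<notin> N1 \<Longrightarrow> 0 < e \<Longrightarrow> \<exists>d>0. \<forall>h. 0 < h \<and> h < d \<longrightarrow>
       norm (integral {x..x + h} g /\<^sub>R h - g x) < e"
    using integrable_ccontinuous_explicit[of g] ig[OF g] by (auto simp: box_real)
  obtain N2 where N2: "negligible N2" "\<And>x e. x \<notin> N2 \<Longrightarrow> 0 < e \<Longrightarrow> \<exists>d>0. \<forall>h. 0 < h \<and> h < d \<longrightarrow>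
       norm (integral {x..x + h} (\<lambda>x. g (- x)) /\<^sub>R h - g (- x)) < e"
    using integrable_ccontinuous_explicit[of "\<lambda>x. g (- x)"] ig[OF gm] by (auto simp: box_real)
  have "(?F has_vector_derivative g t) (at t)" if t: "t \<notin> N1" "- t \<notin> N2" for t
    unfolding has_vector_derivative_def has_derivative_at'
  proof (intro conjI allI impI)
    show "bounded_linear (\<lambda>x. x *\<^sub>R g t)" by (rule bounded_linear_scaleR_left)
    fix e :: real assume e: "0 < e"
    obtain d1 where d1: "0 < d1" "\<And>h. 0 < h \<Longrightarrow> h < d1 \<Longrightarrow> norm (integral {t..t + h} g /\<^sub>R h - g t) < e"
      using N1(2)[OF t(1) e] by blast
    obtain d2 where d2: "0 < d2" "\<And>h. 0 < h \<Longrightarrow> h < d2 \<Longrightarrow> norm (integral {- t..- t + h} (\<lambda>x. g (- x)) /\<^sub>R h - g t) < e"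
      using N2(2)[OF t(2) e] by auto
    show "\<exists>d>0. \<forall>x'. 0 < norm (x' - t) \<and> norm (x' - t) < d \<longrightarrow>
      norm (?F x' - ?F t - (x' - t) *\<^sub>R g t) / norm (x' - t) < e"
    proof (intro exI[of _ "min d1 d2"] conjI allI impI)
      show "0 < min d1 d2" using d1 d2 by simp
      fix x' assume x': "0 < norm (x' - t) \<and> norm (x' - t) < min d1 d2"
      define h where "h = \<bar>x' - t\<bar>"
      have h: "0 < h" "h < d1" "h < d2" using x' by (auto simp: h_def)
      have scale: "norm (v - h *\<^sub>R g t) / h = norm (v /\<^sub>R h - g t)" for v
      proof -
        have "v /\<^sub>R h - g t = (v - h *\<^sub>R g t) /\<^sub>R h" using h by (simp add: scaleR_diff_right)
        then show ?thesis using h by (simp add: divide_inverse mult.commute)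
      qed
      show "norm (?F x' - ?F t - (x' - t) *\<^sub>R g t) / norm (x' - t) < e"
      proof (cases "t < x'")
        case True
        then have e1: "x' = t + h" "norm (x' - t) = h" by (auto simp: h_def)
        have "?F x' - ?F t = integral {t..t + h} g"
          using integral_Icc_primitive[OF g, of t x'] True e1 by simp
        then show ?thesis using d1(2)[OF h(1,2)] e1 scale[of "integral {t..t + h} g"] by simp
      next
        case False
        then have e1: "x' = t - h" "norm (x' - t) = h" using x' by (auto simp: h_def)
        have "integral {- t..- t + h} (\<lambda>x. g (- x)) = integral {t - h..t} g"
        proof -
          have "{- t..- t + h} = {- t..- (t - h)}" by simp
          then show ?thesis using Henstock_Kurzweil_Integration.integral_reflect_real[where b = t and a = "t - h" and f = g] by (simp only:)
        qed
        also have "\<dots> = ?F t - ?F x'"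
          using integral_Icc_primitive[OF g, of x' t] False e1 h by simp
        finally have "?F x' - ?F t - (x' - t) *\<^sub>R g t = - (integral {- t..- t + h} (\<lambda>x. g (- x)) - h *\<^sub>R g t)"
          using e1 by simp
        then have "norm (?F x' - ?F t - (x' - t) *\<^sub>R g t) = norm (integral {- t..- t + h} (\<lambda>x. g (- x)) - h *\<^sub>R g t)"
          by (simp only: norm_minus_cancel)
        then show ?thesis using d2(2)[OF h(1,3)] e1 scale[of "integral {- t..- t + h} (\<lambda>x. g (- x))"] by simp
      qed
    qed
  qed
  then have "{t. \<not> (?F has_vector_derivative g t) (at t)} \<subseteq> N1 \<union> (\<lambda>x. 0 - x) ` N2"
    by (force intro: image_eqI[of _ _ "- _"])
  then show ?thesis unfolding eventually_ae_filter_negligible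
    using negligible_Un[OF N1(1) negligible_reflect[OF N2(1), of 0]] by blast
qed

text \<open>The singular part v t^(\<alpha>-1) is Gamma(\<alpha>) v times the kernel of order
  \<alpha>, so integration of order 1 - \<alpha> turns it into the constant Gamma(\<alpha>) v, while
  the regular part becomes the primitive of \<open>g\<close>. Derivative and initial value can then
  be read off.\<close>

lemma RL_left_structure:
  fixes x g :: "real \<Rightarrow> 'a::euclidean_space"
  assumes a: "1/2 < \<alpha>" "\<alpha> < 1" and T: "0 < T" and g: "borel_L2 T g"
    and x: "AE t in lebesgue_on {0..T}. x t = frac_int \<alpha> g t + v /\<^sub>R t powr (1 - \<alpha>)"
  shows "L1_on T x"
    and "is_ac_rep T (RL_int_left (1 - \<alpha>) x) (\<lambda>t. Gamma \<alpha> *\<^sub>R v + (LINT \<tau>|lborel. indicator {..<t} \<tau> *\<^sub>R g \<tau>))"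
    and "AE t in lebesgue_on {0..T}. RL_deriv_left T \<alpha> x t = g t"
    and "RL_initial_value T \<alpha> x = Gamma \<alpha> *\<^sub>R v"
proof -
  note [measurable] = borel_L2_measurable[OF g] frac_int_measurable[OF borel_L2_measurable[OF g]]
  let ?F = "\<lambda>t. Gamma \<alpha> *\<^sub>R v + (LINT \<tau>|lborel. indicator {..<t} \<tau> *\<^sub>R g \<tau>)"
  have G: "0 < Gamma \<alpha>" using a by (intro Gamma_real_pos) auto
  \<comment> \<open>A Borel version of \<open>x\<close> that vanishes for t <= 0, as
    \<open>RL_int_left_eq_frac_int\<close> requires; beyond T it may be nonzero.\<close>
  define y where "y = (\<lambda>t. frac_int \<alpha> g t + frac_kernel \<alpha> t *\<^sub>R (Gamma \<alpha> *\<^sub>R v))"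
  have [measurable]: "y \<in> borel_measurable borel" unfolding y_def by measurable
  have xy: "AE t in lebesgue_on {0..T}. x t = y t"
    using x unfolding AE_lebesgue_on_iff by eventually_elim (simp add: y_def power_eq_frac_kernel[OF G])
  have yneg: "y t = 0" if "t \<le> 0" for t
    unfolding y_def frac_int_def frac_kernel_scaleR_eq_0[OF g that] using that by (simp add: frac_kernel_def)
  obtain C where C: "0 \<le> C" "\<And>t. t \<le> T \<Longrightarrow> norm (frac_int \<alpha> g t) \<le> C"
    using frac_int_bounded[OF a(1) g] by metis
  have "integrable lborel (\<lambda>t. indicator {0..T} t *\<^sub>R y t)"
  proof (rule Bochner_Integration.integrable_bound)
    show "integrable lborel (\<lambda>t. C * indicator {0..T} t + (indicator {..T} t * frac_kernel \<alpha> t) * norm (Gamma \<alpha> *\<^sub>R v))"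
      using a by (intro Bochner_Integration.integrable_add integrable_mult_right integrable_mult_left
          integrable_indicator_Icc frac_kernel_integrable) auto
    show "AE t in lborel. norm (indicator {0..T} t *\<^sub>R y t) \<le>
      norm (C * indicator {0..T} t + (indicator {..T} t * frac_kernel \<alpha> t) * norm (Gamma \<alpha> *\<^sub>R v))"
    proof (intro AE_I2)
      fix t
      have k: "0 \<le> frac_kernel \<alpha> t" using a by (intro frac_kernel_nonneg) auto
      show "norm (indicator {0..T} t *\<^sub>R y t) \<le>
        norm (C * indicator {0..T} t + (indicator {..T} t * frac_kernel \<alpha> t) * norm (Gamma \<alpha> *\<^sub>R v))"
      proof (cases "t \<in> {0..T}")
        case True
        have "norm (y t) \<le> C + frac_kernel \<alpha> t * norm (Gamma \<alpha> *\<^sub>R v)"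
          unfolding y_def using k C(2)[of t] True
          by (intro norm_triangle_le add_mono) (auto simp: abs_mult)
        then show ?thesis using True C(1) k by (simp add: abs_mult)
      qed simp
    qed
  qed measurable
  then have "integrable (lebesgue_on {0..T}) y" by (subst lebesgue_on_borel_integrable) auto
  moreover have ym: "y \<in> borel_measurable (lebesgue_on {0..T})" by (rule borel_measurable_lebesgue_on) measurable
  ultimately show "L1_on T x" unfolding L1_on_def
    using integrable_cong_AE[OF borel_measurable_lebesgue_on_AE[OF ym xy] ym xy] by blast
  \<comment> \<open>The point 0 must be left out: there the integral runs over a single point and is
    0, whereas \<open>?F 0\<close> is the initial value \<open>Gamma \<alpha> *\<^sub>R v\<close>.
    This is why the initial value is taken from the continuous representative.\<close>
  have "RL_int_left (1 - \<alpha>) x t = ?F t" if t: "0 < t" "t \<le> T" for t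
  proof -
    have "RL_int_left (1 - \<alpha>) x t = frac_int (1 - \<alpha>) y t"
      by (rule RL_int_left_eq_frac_int[OF _ _ xy t(2)]) (auto intro: yneg)
    also have "\<dots> = (LINT s|lborel. frac_kernel (1 - \<alpha>) (t - s) *\<^sub>R frac_int \<alpha> g s
       + (frac_kernel (1 - \<alpha>) (t - s) * frac_kernel \<alpha> (s - 0)) *\<^sub>R (Gamma \<alpha> *\<^sub>R v))"
      by (simp add: frac_int_def y_def scaleR_add_right mult.assoc)
    also have "\<dots> = (LINT s|lborel. frac_kernel (1 - \<alpha>) (t - s) *\<^sub>R frac_int \<alpha> g s)
       + (LINT s|lborel. (frac_kernel (1 - \<alpha>) (t - s) * frac_kernel \<alpha> (s - 0)) *\<^sub>R (Gamma \<alpha> *\<^sub>R v))"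
      using frac_kernel_convolution[of \<alpha> t 0] a
      by (intro Bochner_Integration.integral_add frac_int_semigroup(2)[OF a g t(2)] integrable_scaleR_left)
         (auto simp: has_bochner_integral_iff)
    also have "(LINT s|lborel. (frac_kernel (1 - \<alpha>) (t - s) * frac_kernel \<alpha> (s - 0)) *\<^sub>R (Gamma \<alpha> *\<^sub>R v)) = Gamma \<alpha> *\<^sub>R v"
      using frac_kernel_convolution[of \<alpha> t 0] a t(1)
      by (subst integral_scaleR_left) (auto simp: has_bochner_integral_iff)
    also have "(LINT s|lborel. frac_kernel (1 - \<alpha>) (t - s) *\<^sub>R frac_int \<alpha> g s) = (LINT \<tau>|lborel. indicator {..<t} \<tau> *\<^sub>R g \<tau>)"
      using frac_int_semigroup(1)[OF a g t(2)] by (simp add: frac_int_def)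
    finally show ?thesis by (simp add: add.commute)
  qed
  then have "AE t in lebesgue_on {0..T}. ?F t = RL_int_left (1 - \<alpha>) x t"
    using AE_lborel_singleton[of 0] by (intro AE_lebesgue_on_of_lborel) (auto elim!: eventually_mono)
  then show R: "is_ac_rep T (RL_int_left (1 - \<alpha>) x) ?F"
    using abs_cont_on_primitive[OF g] by (simp add: is_ac_rep_def)
  have z: "indicator {..<0} \<tau> *\<^sub>R g \<tau> = 0" for \<tau>
    using borel_L2_support[OF g, of \<tau>] by (auto simp: indicator_def)
  have "(LINT \<tau>|lborel. indicator {..<0} \<tau> *\<^sub>R g \<tau>) = 0"
    unfolding z by (rule Bochner_Integration.integral_zero)
  then show "RL_initial_value T \<alpha> x = Gamma \<alpha> *\<^sub>R v"
    unfolding RL_initial_value_def using ac_rep_eq[OF R T, of 0] T by simp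
  have "AE t in lebesgue. ((\<lambda>t. LINT \<tau>|lborel. indicator {..<t} \<tau> *\<^sub>R g \<tau>) has_vector_derivative g t) (at t)"
    by (rule primitive_has_vector_derivative_AE[OF borel_L2_integrable[OF g]])
  then show "AE t in lebesgue_on {0..T}. RL_deriv_left T \<alpha> x t = g t"
    unfolding AE_lebesgue_on_iff
  proof eventually_elim
    case (elim t)
    show ?case
    proof
      assume t: "t \<in> {0..T}"
      have "(?F has_vector_derivative g t) (at t)" using elim by (auto intro!: derivative_eq_intros)
      then have "(?F has_vector_derivative g t) (at t within {0..T})" by (rule has_vector_derivative_at_within)
      note D = this
      \<comment> \<open>The derivative is taken within [0,T], since nothing is known about the
        chosen representative outside the interval.\<close>
      have "(ac_rep T (RL_int_left (1 - \<alpha>) x) has_vector_derivative g t) (at t within {0..T})"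
        by (rule has_vector_derivative_transform[OF t ac_rep_eq[OF R T] D])
      then show "RL_deriv_left T \<alpha> x t = g t"
        unfolding RL_deriv_left_def using vector_derivative_within_cbox[of 0 T t] T t by (simp add: box_real)
    qed
  qed
qed

section \<open>Right-sided operators, duality and the Volterra equation\<close>

lemma lebesgue_on_integral_reflect:
  fixes f :: "real \<Rightarrow> 'a::euclidean_space"
  shows "(LINT t|lebesgue_on {a..b}. f t) = (LINT t|lebesgue_on {c - b..c - a}. f (c - t))"
proof -
  have "(LINT t|lebesgue_on {a..b}. f t) = (LINT t|lebesgue. indicator {a..b} (c - t) *\<^sub>R f (c - t))"
    unfolding lebesgue_integral_on_Icc by (subst lebesgue_integral_real_affine[of "-1" _ c]) simp_all
  also have "\<dots> = (LINT t|lebesgue_on {c - b..c - a}. f (c - t))"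
    unfolding lebesgue_integral_on_Icc
    by (intro Bochner_Integration.integral_cong refl) (auto simp: indicator_def)
  finally show ?thesis .
qed

lemma lebesgue_on_integrable_reflect:
  fixes f :: "real \<Rightarrow> 'a::euclidean_space"
  assumes "integrable (lebesgue_on {0..T}) f"
  shows "integrable (lebesgue_on {0..T}) (\<lambda>t. f (T - t))"
proof -
  have "integrable lebesgue (\<lambda>t. indicator {0..T} (T + (-1) * t) *\<^sub>R f (T + (-1) * t))"
    using assms unfolding integrable_lebesgue_on_Icc by (subst lebesgue_integrable_real_affine_iff) simp_all
  also have "(\<lambda>t. indicator {0..T} (T + (-1) * t) *\<^sub>R f (T + (-1) * t)) = (\<lambda>t. indicator {0..T} t *\<^sub>R f (T - t))"
    by (auto simp: indicator_def)
  finally show ?thesis unfolding integrable_lebesgue_on_Icc .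
qed

text \<open>The bridge by which the right-sided theory is inherited from the left-sided one.\<close>

lemma RL_int_right_reflect:
  fixes h :: "real \<Rightarrow> 'a::euclidean_space"
  shows "RL_int_right T \<beta> h t = RL_int_left \<beta> (\<lambda>s. h (T - s)) (T - t)"
  unfolding RL_int_right_def RL_int_left_def
  by (subst lebesgue_on_integral_reflect[where c = T]) (simp add: algebra_simps)

text \<open>Reflecting a family of intervals preserves lengths and disjointness; the end points are
  exchanged so that each pair stays ordered.\<close>

lemma abs_cont_on_reflect:
  assumes F: "abs_cont_on 0 T F"
  shows "abs_cont_on 0 T (\<lambda>t. F (T - t))"
  unfolding abs_cont_on_def
proof (intro allI impI)
  fix \<epsilon> :: real assume e: "0 < \<epsilon>"
  obtain \<delta> where d: "0 < \<delta> \<and> (\<forall>P. finite P \<and> (\<forall>(s, t)\<in>P. 0 \<le> s \<and> s \<le> t \<and> t \<le> T) \<and>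
        disjoint_family_on (\<lambda>(s, t). {s<..<t}) P \<and> (\<Sum>(s, t)\<in>P. t - s) < \<delta>
        \<longrightarrow> (\<Sum>(s, t)\<in>P. norm (F t - F s)) < \<epsilon>)"
    using F[unfolded abs_cont_on_def, THEN spec, THEN mp, OF e] ..
  show "\<exists>\<delta>>0. \<forall>P. finite P \<and> (\<forall>(s, t)\<in>P. 0 \<le> s \<and> s \<le> t \<and> t \<le> T) \<and>
        disjoint_family_on (\<lambda>(s, t). {s<..<t}) P \<and> (\<Sum>(s, t)\<in>P. t - s) < \<delta>
        \<longrightarrow> (\<Sum>(s, t)\<in>P. norm (F (T - t) - F (T - s))) < \<epsilon>"
  proof (intro exI[of _ \<delta>] conjI allI impI)
    show "0 < \<delta>" using d ..
    fix P :: "(real \<times> real) set"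
    assume "finite P \<and> (\<forall>(s, t)\<in>P. 0 \<le> s \<and> s \<le> t \<and> t \<le> T) \<and>
        disjoint_family_on (\<lambda>(s, t). {s<..<t}) P \<and> (\<Sum>(s, t)\<in>P. t - s) < \<delta>"
    then have P: "finite P" "\<And>s t. (s, t) \<in> P \<Longrightarrow> 0 \<le> s \<and> s \<le> t \<and> t \<le> T"
      "disjoint_family_on (\<lambda>(s, t). {s<..<t}) P" "(\<Sum>(s, t)\<in>P. t - s) < \<delta>" by auto
    define r where "r = (\<lambda>(s, t). (T - t, T - s))"
    have inj: "inj_on r P" by (auto simp: inj_on_def r_def)
    have dis: "disjoint_family_on (\<lambda>(s, t). {s<..<t}) (r ` P)"
      unfolding disjoint_family_on_def
    proof (intro ballI impI)
      fix p q assume "p \<in> r ` P" "q \<in> r ` P" and ne: "p \<noteq> q"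
      then obtain s t s' t' where st: "(s, t) \<in> P" "(s', t') \<in> P" "p = (T - t, T - s)" "q = (T - t', T - s')"
        by (auto simp: r_def)
      have "{s<..<t} \<inter> {s'<..<t'} = {}"
        using P(3) st ne by (force simp: disjoint_family_on_def)
      then have "x \<notin> {T - t'<..<T - s'}" if "x \<in> {T - t<..<T - s}" for x
        using that by (auto simp: set_eq_iff dest: spec[of _ "T - x"])
      then show "(case p of (s, t) \<Rightarrow> {s<..<t}) \<inter> (case q of (s, t) \<Rightarrow> {s<..<t}) = {}"
        unfolding st prod.case by blast
    qed
    have "(\<Sum>(s, t)\<in>r ` P. norm (F t - F s)) < \<epsilon>"
    proof (rule conjunct2[OF d, THEN spec, THEN mp], intro conjI)
      show "\<forall>(s, t)\<in>r ` P. 0 \<le> s \<and> s \<le> t \<and> t \<le> T" using P(2) by (auto simp: r_def)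
      show "(\<Sum>(s, t)\<in>r ` P. t - s) < \<delta>"
        using P(4) by (subst sum.reindex[OF inj]) (simp add: r_def split_beta)
    qed (use P(1) dis in auto)
    then show "(\<Sum>(s, t)\<in>P. norm (F (T - t) - F (T - s))) < \<epsilon>"
      by (subst (asm) sum.reindex[OF inj]) (simp add: r_def split_beta norm_minus_commute)
  qed
qed

lemma borel_L2_reflect:
  assumes g: "borel_L2 T g"
  shows "borel_L2 T (\<lambda>t. g (T - t))"
  unfolding borel_L2_def
proof (intro conjI allI impI)
  note [measurable] = borel_L2_measurable[OF g]
  show "(\<lambda>t. g (T - t)) \<in> borel_measurable borel" by measurable
  show "g (T - t) = 0" if "t \<notin> {0..T}" for t using borel_L2_support[OF g, of "T - t"] that by auto
  show "integrable lborel (\<lambda>t. (norm (g (T - t)))\<^sup>2)"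
    using integrable_reflect_lborel[of "\<lambda>t. (norm (g t))\<^sup>2" T] borel_L2_square[OF g] by simp
qed

text \<open>Defined through time reversal, so that boundedness and solvability carry over directly;
  the kernel formula is recovered in \<open>frac_int_right_eq\<close>.\<close>

definition frac_int_right :: "real \<Rightarrow> real \<Rightarrow> (real \<Rightarrow> 'a::euclidean_space) \<Rightarrow> real \<Rightarrow> 'a" where
  "frac_int_right T \<beta> g t = frac_int \<beta> (\<lambda>s. g (T - s)) (T - t)"

lemma frac_int_right_eq: "frac_int_right T \<beta> g t = (LINT \<tau>|lborel. frac_kernel \<beta> (\<tau> - t) *\<^sub>R g \<tau>)"
  unfolding frac_int_right_def frac_int_def
  by (subst integral_reflect_lborel[of _ T, symmetric]) (simp add: algebra_simps)

lemma RL_int_left_borel_L2: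
  assumes g: "borel_L2 T g" and ae: "AE \<tau> in lebesgue_on {0..T}. f \<tau> = g \<tau>" and t: "t \<in> {0..T}"
  shows "RL_int_left \<beta> f t = frac_int \<beta> g t"
  by (rule RL_int_left_eq_frac_int[OF borel_L2_measurable[OF g] _ ae])
     (use t in \<open>auto intro!: borel_L2_support[OF g]\<close>)

lemma RL_int_right_borel_L2:
  assumes g: "borel_L2 T g" and t: "t \<in> {0..T}"
  shows "RL_int_right T \<beta> g t = frac_int_right T \<beta> g t"
  unfolding RL_int_right_reflect frac_int_right_def
  by (rule RL_int_left_borel_L2[OF borel_L2_reflect[OF g]]) (use t in auto)

text \<open>Time reversal of \<open>RL_left_structure\<close> with singular coefficient 0, which is
  why the terminal value is 0. The minus sign in the right-sided derivative cancels the one produced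
  by the chain rule.\<close>

lemma RL_right_structure:
  fixes x g :: "real \<Rightarrow> 'a::euclidean_space"
  assumes a: "1/2 < \<alpha>" "\<alpha> < 1" and T: "0 < T" and g: "borel_L2 T g"
    and x: "\<And>t. t \<in> {0..T} \<Longrightarrow> x t = frac_int_right T \<alpha> g t"
  shows "x \<in> RL_int_right_L2 T \<alpha>"
    and "RL_differentiable_right T \<alpha> x"
    and "AE t in lebesgue_on {0..T}. RL_deriv_right T \<alpha> x t = g t"
    and "RL_terminal_value T \<alpha> x = 0"
proof -
  let ?g = "\<lambda>s. g (T - s)"
  let ?F = "\<lambda>t. LINT \<tau>|lborel. indicator {..<t} \<tau> *\<^sub>R ?g \<tau>"
  note gr = borel_L2_reflect[OF g]
  have "AE t in lebesgue_on {0..T}. x (T - t) = frac_int \<alpha> ?g t + 0 /\<^sub>R t powr (1 - \<alpha>)"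
    using x by (auto simp: AE_lebesgue_on_iff frac_int_right_def)
  note L = RL_left_structure[OF a T gr this]
  have R: "is_ac_rep T (RL_int_left (1 - \<alpha>) (\<lambda>t. x (T - t))) ?F" using L(2) by simp
  have "AE t in lebesgue_on {0..T}. ?F (T - t) = RL_int_left (1 - \<alpha>) (\<lambda>t. x (T - t)) (T - t)"
    using R by (intro AE_lebesgue_on_reflect) (simp add: is_ac_rep_def)
  then have R': "is_ac_rep T (RL_int_right T (1 - \<alpha>) x) (\<lambda>t. ?F (T - t))"
    unfolding is_ac_rep_def RL_int_right_reflect using R
    by (auto simp: is_ac_rep_def intro!: abs_cont_on_reflect)
  show "x \<in> RL_int_right_L2 T \<alpha>" unfolding RL_int_right_L2_def mem_Collect_eq
    using x RL_int_right_borel_L2[OF g] borel_L2_imp_L2_on[OF g]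
    by (intro exI[of _ g]) (auto simp: AE_lebesgue_on_iff)
  have "L1_on T x" using lebesgue_on_integrable_reflect[of T "\<lambda>t. x (T - t)"] L(1) by (simp add: L1_on_def)
  then show "RL_differentiable_right T \<alpha> x" using R' by (auto simp: RL_differentiable_right_def)
  have "ac_rep T (RL_int_left (1 - \<alpha>) (\<lambda>t. x (T - t))) 0 = 0" using L(4) by (simp add: RL_initial_value_def)
  then have "?F 0 = 0" using ac_rep_eq[OF R T, of 0] T by simp
  then show "RL_terminal_value T \<alpha> x = 0"
    unfolding RL_terminal_value_def using ac_rep_eq[OF R' T, of T] T by simp
  have "AE t in lebesgue. (?F has_vector_derivative ?g t) (at t)"
    by (rule primitive_has_vector_derivative_AE[OF borel_L2_integrable[OF gr]])
  then have "AE t in lebesgue. (?F has_vector_derivative ?g (T - t)) (at (T - t))"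
    by (rule AE_lebesgue_reflect)
  then show "AE t in lebesgue_on {0..T}. RL_deriv_right T \<alpha> x t = g t"
    unfolding AE_lebesgue_on_iff
  proof eventually_elim
    case (elim t)
    show ?case
    proof
      assume t: "t \<in> {0..T}"
      have "((\<lambda>t. T - t) has_vector_derivative (-1)) (at t)" by (auto intro!: derivative_eq_intros)
      from vector_diff_chain_at[OF this elim] have "((\<lambda>t. ?F (T - t)) has_vector_derivative (- g t)) (at t)"
        by (simp add: comp_def)
      then have "((\<lambda>t. ?F (T - t)) has_vector_derivative - g t) (at t within {0..T})" by (rule has_vector_derivative_at_within)
      note D = this
      have "(ac_rep T (RL_int_right T (1 - \<alpha>) x) has_vector_derivative - g t) (at t within {0..T})"
        by (rule has_vector_derivative_transform[OF t ac_rep_eq[OF R' T] D])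
      then have "vector_derivative (ac_rep T (RL_int_right T (1 - \<alpha>) x)) (at t within {0..T}) = - g t"
        using vector_derivative_within_cbox[of 0 T t] T t by (simp add: box_real)
      then show "RL_deriv_right T \<alpha> x t = g t" unfolding RL_deriv_right_def by simp
    qed
  qed
qed

section \<open>Fractional integration by parts\<close>

text \<open>Exchanging the order of integration turns k(t - \<tau>), seen from \<tau>, into the
  kernel of the right-sided integral. Absolute integrability follows from the uniform bound on the
  kernel integral of |h| together with \<open>g\<close> being integrable and zero after T.\<close>

lemma frac_int_duality:
  fixes g h :: "real \<Rightarrow> 'a::euclidean_space"
  assumes a: "1/2 < \<alpha>" and g: "borel_L2 T g" and h: "borel_L2 T h"
  shows "(LINT t|lborel. g t \<bullet> frac_int \<alpha> h t) = (LINT t|lborel. frac_int_right T \<alpha> g t \<bullet> h t)"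
proof -
  note [measurable] = borel_L2_measurable[OF g] borel_L2_measurable[OF h]
  define F where "F = (\<lambda>t \<tau>. g t \<bullet> (frac_kernel \<alpha> (t - \<tau>) *\<^sub>R h \<tau>))"
  have [measurable]: "(\<lambda>(t, \<tau>). F t \<tau>) \<in> borel_measurable (lborel \<Otimes>\<^sub>M lborel)"
    unfolding F_def by measurable
  obtain C where C: "0 \<le> C" "\<And>t. t \<le> T \<Longrightarrow> (LINT \<tau>|lborel. norm (frac_kernel \<alpha> (t - \<tau>) *\<^sub>R h \<tau>)) \<le> C"
    using frac_int_bounded[OF a h] by metis
  have iF: "integrable lborel (F t)" for t
    unfolding F_def using frac_int_integrable(1)[OF a h] by (intro integrable_inner_right)
  have intF: "integrable (lborel \<Otimes>\<^sub>M lborel) (\<lambda>(t, \<tau>). F t \<tau>)"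
  proof (rule lborel_pair.Fubini_integrable)
    have "integrable lborel (\<lambda>t. LINT \<tau>|lborel. norm (F t \<tau>))"
    proof (rule Bochner_Integration.integrable_bound)
      show "integrable lborel (\<lambda>t. norm (g t) * C)"
        using borel_L2_integrable[OF g] by (intro integrable_mult_left integrable_norm)
      show "(\<lambda>t. LINT \<tau>|lborel. norm (F t \<tau>)) \<in> borel_measurable lborel"
        by (rule lborel.borel_measurable_lebesgue_integral) measurable
      show "AE t in lborel. norm (LINT \<tau>|lborel. norm (F t \<tau>)) \<le> norm (norm (g t) * C)"
      proof (intro AE_I2)
        fix t
        have nn: "0 \<le> (LINT \<tau>|lborel. norm (F t \<tau>))" by (intro integral_nonneg_AE) auto
        have "(LINT \<tau>|lborel. norm (F t \<tau>)) \<le> (LINT \<tau>|lborel. norm (g t) * norm (frac_kernel \<alpha> (t - \<tau>) *\<^sub>R h \<tau>))"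
          by (intro integral_mono integrable_norm iF integrable_mult_right frac_int_integrable(1)[OF a h])
             (simp add: F_def Cauchy_Schwarz_ineq2 del: norm_scaleR inner_scaleR_right)
        also have "\<dots> = norm (g t) * (LINT \<tau>|lborel. norm (frac_kernel \<alpha> (t - \<tau>) *\<^sub>R h \<tau>))"
          by (rule integral_mult_right_zero)
        also have "\<dots> \<le> norm (g t) * C"
        proof (cases "t \<le> T")
          case False
          then show ?thesis using borel_L2_support[OF g, of t] by simp
        qed (intro mult_left_mono C, auto)
        finally show "norm (LINT \<tau>|lborel. norm (F t \<tau>)) \<le> norm (norm (g t) * C)" using nn C(1) by simp
      qed
    qed
    then show "integrable lborel (\<lambda>t. LINT \<tau>|lborel. norm (case (t, \<tau>) of (t, \<tau>) \<Rightarrow> F t \<tau>))" by simp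
    show "AE t in lborel. integrable lborel (\<lambda>\<tau>. case (t, \<tau>) of (t, \<tau>) \<Rightarrow> F t \<tau>)" using iF by simp
  qed measurable
  have "(LINT t|lborel. g t \<bullet> frac_int \<alpha> h t) = (LINT t|lborel. LINT \<tau>|lborel. F t \<tau>)"
    unfolding frac_int_def F_def
    by (intro Bochner_Integration.integral_cong refl integral_inner_right[symmetric] frac_int_integrable(1)[OF a h])
  also have "\<dots> = (LINT \<tau>|lborel. LINT t|lborel. F t \<tau>)"
    by (rule lborel_pair.Fubini_integral[OF intF, symmetric])
  also have "\<dots> = (LINT t|lborel. frac_int_right T \<alpha> g t \<bullet> h t)"
  proof (intro Bochner_Integration.integral_cong refl)
    fix \<tau>
    have "integrable lborel (\<lambda>s. frac_kernel \<alpha> (T - \<tau> - s) *\<^sub>R g (T - s))"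
      by (rule frac_int_integrable(1)[OF a borel_L2_reflect[OF g]])
    then have "integrable lborel (\<lambda>t. frac_kernel \<alpha> (t - \<tau>) *\<^sub>R g t)"
      by (subst (asm) integrable_reflect_lborel[of _ T, symmetric]) (simp add: algebra_simps)
    then have "frac_int_right T \<alpha> g \<tau> \<bullet> h \<tau> = (LINT t|lborel. (frac_kernel \<alpha> (t - \<tau>) *\<^sub>R g t) \<bullet> h \<tau>)"
      unfolding frac_int_right_eq by (intro integral_inner_left[symmetric])
    then show "(LINT t|lborel. F t \<tau>) = frac_int_right T \<alpha> g \<tau> \<bullet> h \<tau>"
      by (simp add: F_def)
  qed
  finally show ?thesis .
qed

section \<open>Fractional Volterra equations\<close>

text \<open>The Laplace transform of the kernel, by scaling the Gamma integral. It tends to 0 as k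
  grows, which is the source of the contraction.\<close>

lemma frac_kernel_laplace:
  assumes a: "0 < \<alpha>" and k: "0 < k"
  shows "has_bochner_integral lborel (\<lambda>s. frac_kernel \<alpha> s * exp (- k * s)) (k powr (- \<alpha>))"
proof -
  have G: "0 < Gamma \<alpha>" using a by (simp add: Gamma_real_pos)
  have "has_bochner_integral lborel (\<lambda>x. indicator {0..} x * (x powr (\<alpha> - 1) / exp x)) (Gamma \<alpha>)"
    using Gamma_integral_real[OF a] by (intro has_integral_imp_has_bochner_integral_lborel) auto
  then have "has_bochner_integral lborel (\<lambda>s. indicator {0..} (0 + k * s) * ((0 + k * s) powr (\<alpha> - 1) / exp (0 + k * s))) (Gamma \<alpha> /\<^sub>R \<bar>k\<bar>)"
    using k by (subst (asm) lborel_has_bochner_integral_real_affine_iff[of k _ _ 0]) auto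
  then have "has_bochner_integral lborel (\<lambda>s. (indicator {0..} (0 + k * s) * ((0 + k * s) powr (\<alpha> - 1) / exp (0 + k * s))) * (k powr (1 - \<alpha>) / Gamma \<alpha>))
     ((Gamma \<alpha> /\<^sub>R \<bar>k\<bar>) * (k powr (1 - \<alpha>) / Gamma \<alpha>))"
    by (rule has_bochner_integral_mult_left)
  moreover have "(\<lambda>s. (indicator {0..} (0 + k * s) * ((0 + k * s) powr (\<alpha> - 1) / exp (0 + k * s))) * (k powr (1 - \<alpha>) / Gamma \<alpha>))
     = (\<lambda>s. frac_kernel \<alpha> s * exp (- k * s))"
  proof
    fix s :: real
    have kk: "k powr (\<alpha> - 1) * k powr (1 - \<alpha>) = 1" using k by (simp add: powr_add[symmetric])
    show "(indicator {0..} (0 + k * s) * ((0 + k * s) powr (\<alpha> - 1) / exp (0 + k * s))) * (k powr (1 - \<alpha>) / Gamma \<alpha>)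
     = frac_kernel \<alpha> s * exp (- k * s)"
    proof (cases "0 < s")
      case True
      then have "(indicator {0..} (0 + k * s) * ((0 + k * s) powr (\<alpha> - 1) / exp (0 + k * s))) * (k powr (1 - \<alpha>) / Gamma \<alpha>)
        = (k powr (\<alpha> - 1) * k powr (1 - \<alpha>)) * (s powr (\<alpha> - 1) / Gamma \<alpha> * exp (- k * s))"
        using k by (simp add: powr_mult exp_minus field_simps)
      then show ?thesis unfolding kk using True by (simp add: frac_kernel_def)
    next
      case False
      then show ?thesis using k
        by (cases "s = 0") (auto simp: frac_kernel_def indicator_def zero_le_mult_iff)
    qed
  qed
  moreover have "(Gamma \<alpha> /\<^sub>R \<bar>k\<bar>) * (k powr (1 - \<alpha>) / Gamma \<alpha>) = k powr (- \<alpha>)"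
    using G k by (simp add: powr_diff powr_minus field_simps)
  ultimately show ?thesis by simp
qed

text \<open>Writing exp(k \<tau>) = exp(k t) exp(-k (t - \<tau>)) shows that convolution reproduces
  the exponential weight, multiplied by the Laplace transform of the kernel.\<close>

lemma frac_int_exp_bound:
  fixes h :: "real \<Rightarrow> 'a::euclidean_space"
  assumes a: "0 < \<alpha>" and k: "0 < k" and [measurable]: "h \<in> borel_measurable borel"
    and h: "\<And>\<tau>. norm (h \<tau>) \<le> M * exp (k * \<tau>)"
  shows "integrable lborel (\<lambda>\<tau>. frac_kernel \<alpha> (t - \<tau>) *\<^sub>R h \<tau>)"
    and "(LINT \<tau>|lborel. norm (frac_kernel \<alpha> (t - \<tau>) *\<^sub>R h \<tau>)) \<le> M * k powr (- \<alpha>) * exp (k * t)"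
proof -
  have k0: "0 \<le> frac_kernel \<alpha> s" for s using a by (rule frac_kernel_nonneg)
  let ?K = "\<lambda>\<tau>. frac_kernel \<alpha> (t - \<tau>) * exp (- k * (t - \<tau>))"
  have K: "integrable lborel ?K" "(LINT \<tau>|lborel. ?K \<tau>) = k powr (- \<alpha>)"
    using frac_kernel_laplace[OF a k] integrable_reflect_lborel[of "\<lambda>s. frac_kernel \<alpha> s * exp (- k * s)" t]
      integral_reflect_lborel[of "\<lambda>s. frac_kernel \<alpha> s * exp (- k * s)" t]
    by (auto simp: has_bochner_integral_iff)
  have bd: "norm (frac_kernel \<alpha> (t - \<tau>) *\<^sub>R h \<tau>) \<le> M * exp (k * t) * ?K \<tau>" for \<tau>
  proof -
    have "norm (frac_kernel \<alpha> (t - \<tau>) *\<^sub>R h \<tau>) \<le> frac_kernel \<alpha> (t - \<tau>) * (M * exp (k * \<tau>))"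
      using k0 h by (simp add: mult_left_mono)
    also have "exp (k * \<tau>) = exp (k * t) * exp (- k * (t - \<tau>))"
      by (simp add: exp_add[symmetric] algebra_simps)
    finally show ?thesis by (simp add: mult_ac)
  qed
  have iK: "integrable lborel (\<lambda>\<tau>. M * exp (k * t) * ?K \<tau>)" using K(1) by (intro integrable_mult_right)
  show i: "integrable lborel (\<lambda>\<tau>. frac_kernel \<alpha> (t - \<tau>) *\<^sub>R h \<tau>)"
    by (rule Bochner_Integration.integrable_bound[OF iK]) (measurable, intro AE_I2 order_trans[OF bd], simp)
  have "(LINT \<tau>|lborel. norm (frac_kernel \<alpha> (t - \<tau>) *\<^sub>R h \<tau>)) \<le> (LINT \<tau>|lborel. M * exp (k * t) * ?K \<tau>)"
    by (intro integral_mono integrable_norm i iK bd)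
  also have "\<dots> = M * exp (k * t) * k powr (- \<alpha>)"
    by (subst integral_mult_right_zero) (simp only: K(2))
  finally show "(LINT \<tau>|lborel. norm (frac_kernel \<alpha> (t - \<tau>) *\<^sub>R h \<tau>)) \<le> M * k powr (- \<alpha>) * exp (k * t)"
    by (simp add: mult_ac)
qed

text \<open>The Neumann series of the Volterra operator converges since the weight \<open>exp (k * t)\<close>,
  for \<open>k\<close> large, turns it into a contraction with factor \<open>1/2\<close>.\<close>

lemma frac_volterra_solution:
  fixes A :: "'a::euclidean_space \<Rightarrow> 'a" and F :: "real \<Rightarrow> 'a"
  assumes a: "1/2 < \<alpha>" and T: "0 < T" and A: "bounded_linear A" and F: "borel_L2 T F"
  obtains g where "borel_L2 T g" "\<And>t. t \<in> {0..T} \<Longrightarrow> g t = F t + A (frac_int \<alpha> g t)"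
proof -
  obtain B where B: "0 < B" "\<And>x. norm (A x) \<le> norm x * B" using bounded_linear.pos_bounded[OF A] by auto
  obtain C where C: "0 \<le> C" "\<And>t. t \<le> T \<Longrightarrow> norm (frac_int \<alpha> F t) \<le> C"
    using frac_int_bounded[OF a F] by metis
  \<comment> \<open>Solves B k^(-\<alpha>) = 1/2, where B bounds the operator norm of
    \<open>A\<close>.\<close>
  define k where "k = (2 * B) powr (1 / \<alpha>)"
  have k: "0 < k" using B by (simp add: k_def)
  have kB: "B * k powr (- \<alpha>) = 1 / 2" using a B(1) by (simp add: k_def powr_powr powr_minus field_simps)
  note [measurable] = borel_measurable_continuous_onI[OF linear_continuous_on[OF A]] borel_L2_measurable[OF F]
  have A0: "A 0 = 0" using linear_simps(3)[OF A] .
  \<comment> \<open>The iteration runs on \<psi> = I^\<alpha> g instead of g, since I^\<alpha> F is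
    bounded while \<open>F\<close> is merely in L^2. Truncation to [0,T] does not disturb it: the
    fractional integral at t <= T never sees values after T.\<close>
  define H where "H = rec_nat (\<lambda>t. indicator {0..T} t *\<^sub>R frac_int \<alpha> F t)
    (\<lambda>n h t. indicator {0..T} t *\<^sub>R frac_int \<alpha> (\<lambda>s. A (h s)) t)"
  have H0: "H 0 t = indicator {0..T} t *\<^sub>R frac_int \<alpha> F t" for t by (simp add: H_def)
  have HS: "H (Suc n) t = indicator {0..T} t *\<^sub>R frac_int \<alpha> (\<lambda>s. A (H n s)) t" for n t by (simp add: H_def)
  have Hm[measurable]: "H n \<in> borel_measurable borel" for n
  proof (induction n)
    case 0
    have [measurable]: "frac_int \<alpha> F \<in> borel_measurable borel" by (rule frac_int_measurable) measurable
    have "(\<lambda>t. indicator {0..T} t *\<^sub>R frac_int \<alpha> F t) \<in> borel_measurable borel" by measurable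
    then show ?case by (simp add: H0[abs_def])
  next
    case (Suc n)
    note [measurable] = Suc
    have [measurable]: "frac_int \<alpha> (\<lambda>s. A (H n s)) \<in> borel_measurable borel" by (rule frac_int_measurable) measurable
    have "(\<lambda>t. indicator {0..T} t *\<^sub>R frac_int \<alpha> (\<lambda>s. A (H n s)) t) \<in> borel_measurable borel" by measurable
    then show ?case by (simp add: HS[abs_def])
  qed
  have Hb: "norm (H n t) \<le> C * (1/2) ^ n * exp (k * t)" for n t
  proof (induction n arbitrary: t)
    case 0
    show ?case
    proof (cases "t \<in> {0..T}")
      case True
      then have "norm (H 0 t) \<le> C * 1" using C by (simp add: H0)
      also have "\<dots> \<le> C * exp (k * t)" using C k True by (intro mult_left_mono) auto
      finally show ?thesis by simp
    qed (use C in \<open>simp add: H0\<close>)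
  next
    case (Suc n)
    have b: "norm (A (H n \<tau>)) \<le> (C * (1/2) ^ n * B) * exp (k * \<tau>)" for \<tau>
      using order_trans[OF B(2) mult_right_mono[OF Suc]] B(1) by (simp add: mult_ac)
    have "norm (H (Suc n) t) \<le> norm (frac_int \<alpha> (\<lambda>s. A (H n s)) t)" by (simp add: HS indicator_def)
    also have "\<dots> \<le> (LINT \<tau>|lborel. norm (frac_kernel \<alpha> (t - \<tau>) *\<^sub>R A (H n \<tau>)))"
      unfolding frac_int_def by (rule integral_norm_bound)
    also have "\<dots> \<le> (C * (1/2) ^ n * B) * k powr (- \<alpha>) * exp (k * t)"
      by (rule frac_int_exp_bound(2)[OF _ k _ b]) (use a in auto)
    also have "\<dots> = C * (1/2) ^ n * (B * k powr (- \<alpha>)) * exp (k * t)" by (simp add: mult_ac)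
    also have "\<dots> = C * (1/2) ^ Suc n * exp (k * t)" unfolding kB by simp
    finally show ?case .
  qed
  have Ab: "norm (A (H n \<tau>)) \<le> (C * (1/2) ^ n * B) * exp (k * \<tau>)" for n \<tau>
    using order_trans[OF B(2) mult_right_mono[OF Hb[of n \<tau>]]] B(1) by (simp add: mult_ac)
  have Hsupp: "H n t = 0" if "t \<notin> {0..T}" for n t using that by (cases n) (simp_all add: H0 HS)
  have geo: "summable (\<lambda>n. c * (1/2) ^ n :: real)" for c by (intro summable_mult summable_geometric) simp
  have sumn: "summable (\<lambda>n. norm (H n t))" for t
  proof (rule summable_comparison_test'[OF geo[of "C * exp (k * t)"], of 0])
    show "norm (norm (H n t)) \<le> C * exp (k * t) * (1/2) ^ n" for n using Hb[of n t] by (simp add: mult_ac)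
  qed
  then have sum: "summable (\<lambda>n. H n t)" for t by (rule summable_norm_cancel)
  define \<psi> where "\<psi> = (\<lambda>t. \<Sum>n. H n t)"
  have pm[measurable]: "\<psi> \<in> borel_measurable borel" unfolding \<psi>_def by measurable
  have psupp: "\<psi> t = 0" if "t \<notin> {0..T}" for t using Hsupp[OF that] by (simp add: \<psi>_def)
  have pb: "norm (\<psi> t) \<le> 2 * C * exp (k * T)" if "t \<in> {0..T}" for t
  proof -
    have "norm (\<psi> t) \<le> (\<Sum>n. norm (H n t))" unfolding \<psi>_def by (rule summable_norm[OF sumn])
    also have "\<dots> \<le> (\<Sum>n. C * exp (k * T) * (1/2) ^ n)"
    proof (rule suminf_le[OF _ sumn geo])
      fix n
      have "C * (1/2) ^ n * exp (k * t) \<le> C * (1/2) ^ n * exp (k * T)"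
        using that k C by (intro mult_left_mono) auto
      then show "norm (H n t) \<le> C * exp (k * T) * (1/2) ^ n" using Hb[of n t] by (simp add: mult_ac)
    qed
    also have "\<dots> = 2 * C * exp (k * T)" by (subst suminf_mult) (simp_all add: suminf_geometric)
    finally show ?thesis .
  qed
  have Apsi: "borel_L2 T (\<lambda>t. A (\<psi> t))"
    by (rule borel_L2_linear[OF borel_L2_bounded[OF pm psupp pb] A])
  \<comment> \<open>Integrating the series term by term shifts the index by one, so that exactly the
    term \<open>H 0\<close> is lost.\<close>
  have frac_psi: "frac_int \<alpha> (\<lambda>t. A (\<psi> t)) t = \<psi> t - H 0 t" if t: "t \<in> {0..T}" for t
  proof -
    have "frac_int \<alpha> (\<lambda>t. A (\<psi> t)) t = (LINT \<tau>|lborel. (\<Sum>n. frac_kernel \<alpha> (t - \<tau>) *\<^sub>R A (H n \<tau>)))"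
      unfolding frac_int_def
    proof (intro Bochner_Integration.integral_cong refl)
      fix \<tau>
      have "bounded_linear (\<lambda>x. frac_kernel \<alpha> (t - \<tau>) *\<^sub>R A x)"
        by (intro bounded_linear_const_scaleR A)
      then show "frac_kernel \<alpha> (t - \<tau>) *\<^sub>R A (\<psi> \<tau>) = (\<Sum>n. frac_kernel \<alpha> (t - \<tau>) *\<^sub>R A (H n \<tau>))"
        unfolding \<psi>_def by (rule bounded_linear.suminf[OF _ sum])
    qed
    also have "\<dots> = (\<Sum>n. LINT \<tau>|lborel. frac_kernel \<alpha> (t - \<tau>) *\<^sub>R A (H n \<tau>))"
    proof (rule integral_suminf)
      show "integrable lborel (\<lambda>\<tau>. frac_kernel \<alpha> (t - \<tau>) *\<^sub>R A (H n \<tau>))" for n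
        by (rule frac_int_exp_bound(1)[OF _ k _ Ab]) (use a in auto)
      show "AE \<tau> in lborel. summable (\<lambda>n. norm (frac_kernel \<alpha> (t - \<tau>) *\<^sub>R A (H n \<tau>)))"
      proof (intro AE_I2)
        fix \<tau>
        show "summable (\<lambda>n. norm (frac_kernel \<alpha> (t - \<tau>) *\<^sub>R A (H n \<tau>)))"
          by (rule summable_comparison_test'[OF summable_mult[OF summable_mult2[OF sumn, of \<tau> B], of "\<bar>frac_kernel \<alpha> (t - \<tau>)\<bar>"], of 0])
             (use B in \<open>simp add: mult_left_mono\<close>)
      qed
      show "summable (\<lambda>n. LINT \<tau>|lborel. norm (frac_kernel \<alpha> (t - \<tau>) *\<^sub>R A (H n \<tau>)))"
      proof (rule summable_comparison_test'[OF geo, of 0])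
        fix n
        have "0 \<le> (LINT \<tau>|lborel. norm (frac_kernel \<alpha> (t - \<tau>) *\<^sub>R A (H n \<tau>)))" by (intro integral_nonneg_AE) auto
        moreover have "(LINT \<tau>|lborel. norm (frac_kernel \<alpha> (t - \<tau>) *\<^sub>R A (H n \<tau>))) \<le> (C * (1/2) ^ n * B) * k powr (- \<alpha>) * exp (k * t)"
          by (rule frac_int_exp_bound(2)[OF _ k _ Ab]) (use a in auto)
        ultimately show "norm (LINT \<tau>|lborel. norm (frac_kernel \<alpha> (t - \<tau>) *\<^sub>R A (H n \<tau>))) \<le> (C * B * k powr (- \<alpha>) * exp (k * t)) * (1/2) ^ n"
          by (simp add: mult_ac)
      qed
    qed
    also have "\<dots> = (\<Sum>n. H (Suc n) t)" using t by (simp add: HS frac_int_def)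
    also have "\<dots> = \<psi> t - H 0 t" unfolding \<psi>_def by (subst suminf_split_head[OF sum]) simp
    finally show ?thesis .
  qed
  \<comment> \<open>Its fractional integral is I^\<alpha> F + (\<psi> - H 0), which is \<psi> on
    [0,T]; so the equation holds at every point, not just almost everywhere.\<close>
  let ?g = "\<lambda>t. F t + A (\<psi> t)"
  have g: "borel_L2 T ?g" by (rule borel_L2_add[OF F Apsi])
  have "?g t = F t + A (frac_int \<alpha> ?g t)" if t: "t \<in> {0..T}" for t
  proof -
    have "frac_int \<alpha> ?g t = frac_int \<alpha> F t + frac_int \<alpha> (\<lambda>t. A (\<psi> t)) t"
      by (rule frac_int_add[OF a F Apsi])
    also have "\<dots> = \<psi> t" using frac_psi[OF t] t by (simp add: H0)
    finally show ?thesis by simp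
  qed
  then show ?thesis using that g by blast
qed

section \<open>The linear-quadratic structure of the problem\<close>

lemma L2_on_add:
  assumes f: "L2_on T f" and g: "L2_on T g"
  shows "L2_on T (\<lambda>t. f t + g t)"
proof -
  obtain fb where fb: "borel_L2 T fb" "AE t in lebesgue_on {0..T}. f t = fb t" using borel_L2_rep[OF f] .
  obtain gb where gb: "borel_L2 T gb" "AE t in lebesgue_on {0..T}. g t = gb t" using borel_L2_rep[OF g] .
  have "AE t in lebesgue_on {0..T}. f t + g t = fb t + gb t" using fb(2) gb(2) by eventually_elim simp
  then show ?thesis by (rule L2_on_cong_AE[OF borel_L2_imp_L2_on[OF borel_L2_add[OF fb(1) gb(1)]]])
qed

lemma L2_on_linear:
  fixes A :: "'a::euclidean_space \<Rightarrow> 'b::euclidean_space"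
  assumes f: "L2_on T f" and A: "bounded_linear A"
  shows "L2_on T (\<lambda>t. A (f t))"
proof -
  obtain fb where fb: "borel_L2 T fb" "AE t in lebesgue_on {0..T}. f t = fb t" using borel_L2_rep[OF f] .
  have "AE t in lebesgue_on {0..T}. A (f t) = A (fb t)" using fb(2) by eventually_elim simp
  then show ?thesis by (rule L2_on_cong_AE[OF borel_L2_imp_L2_on[OF borel_L2_linear[OF fb(1) A]]])
qed

lemma L2_on_bounded:
  fixes f :: "real \<Rightarrow> 'a::euclidean_space"
  assumes f: "f \<in> borel_measurable (lebesgue_on {0..T})" and B: "\<And>t. t \<in> {0..T} \<Longrightarrow> norm (f t) \<le> B"
  shows "L2_on T f"
proof -
  have "integrable (lebesgue_on {0..T}) (\<lambda>t. B\<^sup>2)"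
    by (subst lebesgue_on_borel_integrable) (auto simp: emeasure_lborel_Icc_eq)
  then have "integrable (lebesgue_on {0..T}) (\<lambda>t. (norm (f t))\<^sup>2)"
    by (rule Bochner_Integration.integrable_bound) (use f B in \<open>auto intro!: AE_I2 power_mono simp: space_restrict_space\<close>)
  then show ?thesis using f by (simp add: L2_on_def)
qed

lemma abs_inner_le_squares: "\<bar>x \<bullet> y\<bar> \<le> (norm x)\<^sup>2 + (norm (y::'a::real_inner))\<^sup>2"
proof -
  have "0 \<le> (norm x - norm y)\<^sup>2" by simp
  then have "2 * (norm x * norm y) \<le> (norm x)\<^sup>2 + (norm y)\<^sup>2" by (simp add: power2_eq_square algebra_simps)
  moreover have "0 \<le> norm x * norm y" by simp
  ultimately show ?thesis using Cauchy_Schwarz_ineq2[of x y] by linarith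
qed

lemma L2_inner_integrable:
  assumes f: "L2_on T f" and g: "L2_on T g"
  shows "integrable (lebesgue_on {0..T}) (\<lambda>t. f t \<bullet> g t)"
proof (rule Bochner_Integration.integrable_bound)
  show "integrable (lebesgue_on {0..T}) (\<lambda>t. (norm (f t))\<^sup>2 + (norm (g t))\<^sup>2)"
    using f g by (simp add: L2_on_def)
  show "(\<lambda>t. f t \<bullet> g t) \<in> borel_measurable (lebesgue_on {0..T})"
    using f g by (intro borel_measurable_inner) (simp_all add: L2_on_def)
  show "AE t in lebesgue_on {0..T}. norm (f t \<bullet> g t) \<le> norm ((norm (f t))\<^sup>2 + (norm (g t))\<^sup>2)"
    using abs_inner_le_squares by (intro AE_I2) auto
qed

lemma borel_L2_inner_integrable:
  assumes f: "borel_L2 T f" and g: "borel_L2 T g"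
  shows "integrable lborel (\<lambda>t. f t \<bullet> g t)"
proof (rule Bochner_Integration.integrable_bound)
  note [measurable] = borel_L2_measurable[OF f] borel_L2_measurable[OF g]
  show "integrable lborel (\<lambda>t. (norm (f t))\<^sup>2 + (norm (g t))\<^sup>2)"
    using borel_L2_square[OF f] borel_L2_square[OF g] by simp
  show "(\<lambda>t. f t \<bullet> g t) \<in> borel_measurable lborel" by measurable
  show "AE t in lborel. norm (f t \<bullet> g t) \<le> norm ((norm (f t))\<^sup>2 + (norm (g t))\<^sup>2)"
    using abs_inner_le_squares by (intro AE_I2) auto
qed

lemma borel_L2_truncated_frac_int:
  assumes a: "1/2 < \<alpha>" and g: "borel_L2 T g"
  shows "borel_L2 T (\<lambda>t. indicator {0..T} t *\<^sub>R frac_int \<alpha> g t)"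
proof -
  obtain C where C: "0 \<le> C" "\<And>t. t \<le> T \<Longrightarrow> norm (frac_int \<alpha> g t) \<le> C"
    using frac_int_bounded[OF a g] by metis
  note [measurable] = frac_int_measurable[OF borel_L2_measurable[OF g]]
  show ?thesis by (rule borel_L2_bounded[where B = C]) (use C in auto)
qed

lemma borel_L2_truncated_frac_int_right:
  assumes a: "1/2 < \<alpha>" and g: "borel_L2 T g"
  shows "borel_L2 T (\<lambda>t. indicator {0..T} t *\<^sub>R frac_int_right T \<alpha> g t)"
proof -
  have "(\<lambda>t. indicator {0..T} t *\<^sub>R frac_int_right T \<alpha> g t) =
    (\<lambda>t. indicator {0..T} (T - t) *\<^sub>R frac_int \<alpha> (\<lambda>s. g (T - s)) (T - t))"
    by (auto simp: frac_int_right_def indicator_def)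
  then show ?thesis
    using borel_L2_reflect[OF borel_L2_truncated_frac_int[OF a borel_L2_reflect[OF g]]] by simp
qed

section \<open>Coordinates on the state space\<close>

text \<open>By \<open>RL_left_structure\<close>, \<open>g\<close> represents the fractional
  derivative of \<open>x\<close>, and \<open>Gamma \<alpha> *\<^sub>R v\<close> is its initial
  value.\<close>

definition X_rep :: "real \<Rightarrow> real \<Rightarrow> (real \<Rightarrow> 'a::euclidean_space) \<Rightarrow> (real \<Rightarrow> 'a) \<Rightarrow> 'a \<Rightarrow> bool" where
  "X_rep T \<alpha> x g v \<longleftrightarrow> borel_L2 T g \<and>
     (AE t in lebesgue_on {0..T}. x t = frac_int \<alpha> g t + v /\<^sub>R t powr (1 - \<alpha>))"

lemma X_space_obtain_rep:
  fixes x :: "real \<Rightarrow> 'a::euclidean_space"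
  assumes "x \<in> X_space T \<alpha>"
  obtains g v where "X_rep T \<alpha> x g v"
proof -
  obtain y v \<phi> where y: "AE t in lebesgue_on {0..T}. x t = y t + v /\<^sub>R t powr (1 - \<alpha>)"
    "L2_on T \<phi>" "AE t in lebesgue_on {0..T}. y t = RL_int_left \<alpha> \<phi> t"
    using assms unfolding X_space_def RL_int_left_L2_def by blast
  obtain g where g: "borel_L2 T g" "AE t in lebesgue_on {0..T}. \<phi> t = g t" using borel_L2_rep[OF y(2)] .
  have "AE t in lebesgue_on {0..T}. x t = frac_int \<alpha> g t + v /\<^sub>R t powr (1 - \<alpha>)"
    using y(1,3) unfolding AE_lebesgue_on_iff
    by eventually_elim (use RL_int_left_borel_L2[OF g] in auto)
  then show ?thesis using that g(1) unfolding X_rep_def by blast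
qed

lemma X_rep_in_X_space:
  assumes "X_rep T \<alpha> x g v"
  shows "x \<in> X_space T \<alpha>"
proof -
  have g: "borel_L2 T g" and x: "AE t in lebesgue_on {0..T}. x t = frac_int \<alpha> g t + v /\<^sub>R t powr (1 - \<alpha>)"
    using assms by (auto simp: X_rep_def)
  have "frac_int \<alpha> g \<in> RL_int_left_L2 T \<alpha>" unfolding RL_int_left_L2_def mem_Collect_eq
    using borel_L2_imp_L2_on[OF g] RL_int_left_borel_L2[OF g]
    by (intro exI[of _ g]) (auto simp: AE_lebesgue_on_iff)
  then show ?thesis unfolding X_space_def using x by blast
qed

lemma X_rep_linear:
  fixes L :: "'a::euclidean_space \<Rightarrow> 'b::euclidean_space"
  assumes a: "1/2 < \<alpha>" and x: "X_rep T \<alpha> x g v" and L: "bounded_linear L"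
  shows "X_rep T \<alpha> (\<lambda>t. L (x t)) (\<lambda>t. L (g t)) (L v)"
  unfolding X_rep_def
proof
  have g: "borel_L2 T g" and x: "AE t in lebesgue_on {0..T}. x t = frac_int \<alpha> g t + v /\<^sub>R t powr (1 - \<alpha>)"
    using x by (auto simp: X_rep_def)
  show "borel_L2 T (\<lambda>t. L (g t))" by (rule borel_L2_linear[OF g L])
  show "AE t in lebesgue_on {0..T}. L (x t) = frac_int \<alpha> (\<lambda>t. L (g t)) t + L v /\<^sub>R t powr (1 - \<alpha>)"
    using x by eventually_elim (simp add: frac_int_linear[OF a g L] linear_simps(1,5)[OF L])
qed

lemma X_rep_add:
  fixes x y :: "real \<Rightarrow> 'a::euclidean_space"
  assumes a: "1/2 < \<alpha>" and x: "X_rep T \<alpha> x g v" and y: "X_rep T \<alpha> y h w"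
  shows "X_rep T \<alpha> (\<lambda>t. x t + y t) (\<lambda>t. g t + h t) (v + w)"
  unfolding X_rep_def
proof
  have g: "borel_L2 T g" and h: "borel_L2 T h"
    and xy: "AE t in lebesgue_on {0..T}. x t = frac_int \<alpha> g t + v /\<^sub>R t powr (1 - \<alpha>)"
      "AE t in lebesgue_on {0..T}. y t = frac_int \<alpha> h t + w /\<^sub>R t powr (1 - \<alpha>)"
    using x y by (auto simp: X_rep_def)
  show "borel_L2 T (\<lambda>t. g t + h t)" by (rule borel_L2_add[OF g h])
  show "AE t in lebesgue_on {0..T}. x t + y t = frac_int \<alpha> (\<lambda>t. g t + h t) t + (v + w) /\<^sub>R t powr (1 - \<alpha>)"
    using xy by eventually_elim (simp add: frac_int_add[OF a g h] scaleR_add_right)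
qed

text \<open>The regular part is bounded on [0,T], and the singular part t^(\<alpha>-1) is square
  integrable because \<alpha> > 1/2. This makes the quadratic cost of every state in X
  finite.\<close>

lemma X_rep_L2_on:
  fixes x :: "real \<Rightarrow> 'a::euclidean_space"
  assumes a: "1/2 < \<alpha>" "\<alpha> < 1" and x: "X_rep T \<alpha> x g v"
  shows "L2_on T x"
proof -
  have g: "borel_L2 T g" and x: "AE t in lebesgue_on {0..T}. x t = frac_int \<alpha> g t + v /\<^sub>R t powr (1 - \<alpha>)"
    using x by (auto simp: X_rep_def)
  have G: "0 < Gamma \<alpha>" using a by (intro Gamma_real_pos) auto
  let ?k = "\<lambda>t. (indicator {0..T} t * frac_kernel \<alpha> t) *\<^sub>R (Gamma \<alpha> *\<^sub>R v)"
  have k: "borel_L2 T ?k" unfolding borel_L2_def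
  proof (intro conjI allI impI)
    have "integrable lborel (\<lambda>t. (norm (Gamma \<alpha> *\<^sub>R v))\<^sup>2 * (indicator {..T} t * (frac_kernel \<alpha> t)\<^sup>2))"
      by (intro integrable_mult_right frac_kernel_square_integrable a)
    also have "(\<lambda>t. (norm (Gamma \<alpha> *\<^sub>R v))\<^sup>2 * (indicator {..T} t * (frac_kernel \<alpha> t)\<^sup>2)) = (\<lambda>t. (norm (?k t))\<^sup>2)"
      by (auto simp: fun_eq_iff indicator_def frac_kernel_def power_mult_distrib)
    finally show "integrable lborel (\<lambda>t. (norm (?k t))\<^sup>2)" .
  qed auto
  have "AE t in lebesgue_on {0..T}. x t = indicator {0..T} t *\<^sub>R frac_int \<alpha> g t + ?k t"
    using x unfolding AE_lebesgue_on_iff by eventually_elim (simp add: power_eq_frac_kernel[OF G])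
  then show ?thesis
    by (rule L2_on_cong_AE[OF borel_L2_imp_L2_on[OF borel_L2_add[OF borel_L2_truncated_frac_int[OF a(1) g] k]]])
qed

lemma X_norm_rep:
  fixes x :: "real \<Rightarrow> 'a::euclidean_space"
  assumes a: "1/2 < \<alpha>" "\<alpha> < 1" and T: "0 < T" and x: "X_rep T \<alpha> x g v"
  shows "X_norm T \<alpha> x = norm (Gamma \<alpha> *\<^sub>R v) + L2_norm_on T g"
proof -
  have g: "borel_L2 T g" and x: "AE t in lebesgue_on {0..T}. x t = frac_int \<alpha> g t + v /\<^sub>R t powr (1 - \<alpha>)"
    using x by (auto simp: X_rep_def)
  note L = RL_left_structure[OF a T g x]
  have m: "g \<in> borel_measurable (lebesgue_on {0..T})" by (rule borel_measurable_lebesgue_on[OF borel_L2_measurable[OF g]])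
  note m' = borel_measurable_lebesgue_on_AE[OF m L(3)]
  note [measurable] = m m'
  have "(LINT t|lebesgue_on {0..T}. (norm (RL_deriv_left T \<alpha> x t))\<^sup>2) = (LINT t|lebesgue_on {0..T}. (norm (g t))\<^sup>2)"
  proof (rule integral_cong_AE)
    show "AE t in lebesgue_on {0..T}. (norm (RL_deriv_left T \<alpha> x t))\<^sup>2 = (norm (g t))\<^sup>2"
      using L(3) by eventually_elim simp
  qed measurable
  then show ?thesis unfolding X_norm_def L(4) L2_norm_on_def by simp
qed

text \<open>The system is posed component by component, but projections are linear and commute with
  the fractional integral, so the components of \<open>g\<close> and \<open>v\<close> are
  coordinates of the components of \<open>x\<close>. Finitely many null sets are merged into
  one.\<close>

lemma satisfies_system_rep:
  fixes x :: "real \<Rightarrow> ('d::finite, 'n::finite) state"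
  assumes a: "1/2 < \<alpha>" "\<alpha> < 1" and T: "0 < T" and x: "X_rep T \<alpha> x g v"
  shows "satisfies_system T \<alpha> a c x0 x u \<longleftrightarrow>
    (AE t in lebesgue_on {0..T}. g t = dynamics a c (x t) (u t)) \<and> Gamma \<alpha> *\<^sub>R v = x0"
proof -
  have "X_rep T \<alpha> (\<lambda>t. x t $ k) (\<lambda>t. g t $ k) (v $ k)" for k
    by (rule X_rep_linear[OF a(1) x bounded_linear_vec_nth])
  then have *: "borel_L2 T (\<lambda>t. g t $ k)"
    "AE t in lebesgue_on {0..T}. x t $ k = frac_int \<alpha> (\<lambda>t. g t $ k) t + v $ k /\<^sub>R t powr (1 - \<alpha>)" for k
    by (auto simp: X_rep_def)
  note L = RL_left_structure[OF a T *]
  have D: "RL_differentiable_left T \<alpha> (\<lambda>s. x s $ k)" for k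
    using L(1,2)[of k] by (auto simp: RL_differentiable_left_def)
  have all: "AE t in lebesgue_on {0..T}. \<forall>k. RL_deriv_left T \<alpha> (\<lambda>s. x s $ k) t = g t $ k"
  proof -
    have "AE t in lebesgue_on {0..T}. \<forall>k\<in>UNIV. RL_deriv_left T \<alpha> (\<lambda>s. x s $ k) t = g t $ k"
      using L(3) by (intro AE_finite_allI) auto
    then show ?thesis by simp
  qed
  have "(AE t in lebesgue_on {0..T}. \<forall>k. RL_deriv_left T \<alpha> (\<lambda>s. x s $ k) t = dynamics a c (x t) (u t) $ k) \<longleftrightarrow>
    (AE t in lebesgue_on {0..T}. g t = dynamics a c (x t) (u t))"
    by (rule eventually_subst, use all in eventually_elim) (simp add: vec_eq_iff)
  then show ?thesis unfolding satisfies_system_def using D L(4) by (simp add: vec_eq_iff)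
qed

section \<open>Algebra of the system matrix and of the running cost\<close>

lemma sum_UNIV_option:
  fixes f :: "'n::finite option \<Rightarrow> 'b::comm_monoid_add"
  shows "(\<Sum>k\<in>UNIV. f k) = f None + (\<Sum>i\<in>UNIV. f (Some i))"
  by (simp add: UNIV_option_conv sum.reindex)

lemma bounded_linear_dynamics: "bounded_linear (\<lambda>x. dynamics a c x (0::real^'d::finite) :: ('d, 'n::finite) state)"
  unfolding linear_conv_bounded_linear[symmetric]
  by (rule linearI)
     (auto simp: vec_eq_iff dynamics_def sum.distrib[symmetric] sum_distrib_left algebra_simps split: option.split)

definition leader :: "real ^ 'd::finite \<Rightarrow> ('d, 'n::finite) state" where
  "leader u = (\<chi> k. case k of None \<Rightarrow> u | Some i \<Rightarrow> 0)"

lemma bounded_linear_leader: "bounded_linear (leader :: real ^ 'd::finite \<Rightarrow> ('d, 'n::finite) state)"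
  unfolding linear_conv_bounded_linear[symmetric]
  by (rule linearI) (auto simp: vec_eq_iff leader_def split: option.split)

lemma inner_leader: "x \<bullet> leader u = x $ None \<bullet> u"
  by (simp add: inner_vec_def sum_UNIV_option leader_def)

lemma dynamics_split: "dynamics a c x u = dynamics a c x 0 + leader u"
  by (auto simp: vec_eq_iff dynamics_def leader_def split: option.split)

lemma mat_mult_vec: "mat r *v (x::real^'d) = r *\<^sub>R x"
  by (simp add: vec_eq_iff matrix_vector_mult_def mat_def if_distrib[of "\<lambda>z. z * _"] cong: if_cong)

text \<open>In \<open>dynamics\<close> the summand j = i vanishes, so \<open>a i i\<close> has no
  influence there; accordingly the diagonal block sums over the other indices only.\<close>

lemma block_mult_vec_system_matrix:
  fixes x :: "('d::finite, 'n::finite) state"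
  shows "block_mult_vec (system_matrix a c) x = dynamics a c x 0"
proof (rule vec_eq_iff[THEN iffD2], rule allI)
  fix k :: "'n option"
  show "block_mult_vec (system_matrix a c) x $ k = dynamics a c x 0 $ k"
  proof (cases k)
    case None
    then show ?thesis by (simp add: block_mult_vec_def system_matrix_def dynamics_def)
  next
    case (Some i)
    have "block_mult_vec (system_matrix a c) x $ k = c i *\<^sub>R x $ None +
      (\<Sum>j\<in>UNIV. if j = i then - ((\<Sum>m\<in>UNIV - {i}. a i m) + c i) *\<^sub>R x $ Some i else a i j *\<^sub>R x $ Some j)"
      unfolding block_mult_vec_def Some sum_UNIV_option
      by (auto simp: system_matrix_def mat_mult_vec intro!: sum.cong)
    also have "\<dots> = c i *\<^sub>R x $ None - ((\<Sum>m\<in>UNIV - {i}. a i m) + c i) *\<^sub>R x $ Some i + (\<Sum>j\<in>UNIV - {i}. a i j *\<^sub>R x $ Some j)"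
      by (simp add: sum.remove[of UNIV i] algebra_simps)
    also have "\<dots> = (\<Sum>j\<in>UNIV - {i}. a i j *\<^sub>R (x $ Some j - x $ Some i)) + c i *\<^sub>R (x $ None - x $ Some i)"
      by (simp add: scaleR_diff_right sum_subtractf scaleR_sum_left algebra_simps)
    also have "\<dots> = dynamics a c x 0 $ k"
      unfolding dynamics_def Some by (simp add: sum.remove[of UNIV i])
    finally show ?thesis .
  qed
qed

lemma block_transpose_adjoint:
  fixes x y :: "('d::finite, 'n::finite) state"
  shows "block_mult_vec (block_transpose B) x \<bullet> y = x \<bullet> block_mult_vec B y"
proof -
  have "block_mult_vec (block_transpose B) x \<bullet> y = (\<Sum>k\<in>UNIV. \<Sum>l\<in>UNIV. (transpose (B $ l $ k) *v x $ l) \<bullet> y $ k)"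
    by (simp add: inner_vec_def[of _ y] block_mult_vec_def block_transpose_def inner_sum_left)
  also have "\<dots> = (\<Sum>k\<in>UNIV. \<Sum>l\<in>UNIV. x $ l \<bullet> (B $ l $ k *v y $ k))"
    by (simp add: dot_lmul_matrix)
  also have "\<dots> = (\<Sum>l\<in>UNIV. \<Sum>k\<in>UNIV. x $ l \<bullet> (B $ l $ k *v y $ k))" by (rule sum.swap)
  also have "\<dots> = x \<bullet> block_mult_vec B y"
    by (simp add: inner_vec_def[of x] block_mult_vec_def inner_sum_right)
  finally show ?thesis .
qed

lemma bounded_linear_block_mult_vec: "bounded_linear (block_mult_vec B :: ('d::finite, 'n::finite) state \<Rightarrow> _)"
  unfolding linear_conv_bounded_linear[symmetric]
  by (rule linearI) (auto simp: vec_eq_iff block_mult_vec_def sum.distrib scaleR_sum_right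
      matrix_vector_right_distrib sum_distrib_left matrix_vector_mult_scaleR)

lemma bounded_linear_running_cost_grad:
  "bounded_linear (running_cost_grad :: ('d::finite, 'n::finite) state \<Rightarrow> _)"
  unfolding linear_conv_bounded_linear[symmetric]
  by (rule linearI) (auto simp: vec_eq_iff running_cost_grad_def sum.distrib sum_distrib_left algebra_simps split: option.split)

text \<open>Exhibits the gradient as a symmetric bilinear form whose diagonal is twice the state
  cost. Each unordered pair of agents is counted twice in the double sum; exchanging i and j merges
  the two halves, whence the factor 2/N.\<close>

lemma running_cost_grad_inner:
  fixes x y :: "('d::finite, 'n::finite) state"
  shows "running_cost_grad x \<bullet> y =
    1 / (real CARD('n))\<^sup>2 * (\<Sum>i\<in>UNIV. \<Sum>j\<in>UNIV. (x $ Some i - x $ Some j) \<bullet> (y $ Some i - y $ Some j))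
    + (\<Sum>i\<in>UNIV. (x $ None - x $ Some i) \<bullet> (y $ None - y $ Some i))"
proof -
  let ?N = "real CARD('n)"
  have N: "?N > 0" by simp
  let ?S = "\<Sum>j\<in>UNIV. x $ Some j"
  have 1: "(\<Sum>j\<in>UNIV. (x $ Some i - x $ Some j)) = ?N *\<^sub>R x $ Some i - ?S" for i
    by (simp only: sum_subtractf sum_constant_scaleR)
  have "(\<Sum>i\<in>UNIV. \<Sum>j\<in>UNIV. (x $ Some i - x $ Some j) \<bullet> (y $ Some i - y $ Some j)) =
    (\<Sum>i\<in>UNIV. \<Sum>j\<in>UNIV. (x $ Some i - x $ Some j) \<bullet> y $ Some i) + (\<Sum>i\<in>UNIV. \<Sum>j\<in>UNIV. (x $ Some j - x $ Some i) \<bullet> y $ Some j)"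
    by (simp add: sum.distrib[symmetric] algebra_simps)
  also have "(\<Sum>i\<in>UNIV. \<Sum>j\<in>UNIV. (x $ Some j - x $ Some i) \<bullet> y $ Some j) = (\<Sum>i\<in>UNIV. \<Sum>j\<in>UNIV. (x $ Some i - x $ Some j) \<bullet> y $ Some i)"
    by (rule sum.swap)
  also have "(\<Sum>i\<in>UNIV. \<Sum>j\<in>UNIV. (x $ Some i - x $ Some j) \<bullet> y $ Some i) = (\<Sum>i\<in>UNIV. (?N *\<^sub>R x $ Some i - ?S) \<bullet> y $ Some i)"
    by (simp only: inner_sum_left[symmetric] 1)
  finally have A: "1 / ?N\<^sup>2 * (\<Sum>i\<in>UNIV. \<Sum>j\<in>UNIV. (x $ Some i - x $ Some j) \<bullet> (y $ Some i - y $ Some j)) =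
    (\<Sum>i\<in>UNIV. ((2 / ?N) *\<^sub>R (x $ Some i - (1 / ?N) *\<^sub>R ?S)) \<bullet> y $ Some i)"
    using N by (simp add: sum_distrib_left power2_eq_square inner_diff_left sum.distrib[symmetric] field_simps)
  have B: "(\<Sum>i\<in>UNIV. (x $ None - x $ Some i) \<bullet> (y $ None - y $ Some i)) =
    (?N *\<^sub>R x $ None - ?S) \<bullet> y $ None + (\<Sum>i\<in>UNIV. (x $ Some i - x $ None) \<bullet> y $ Some i)"
    by (simp add: inner_diff_left inner_diff_right sum.distrib sum_subtractf inner_sum_left algebra_simps)
  show ?thesis unfolding A B
    by (simp add: inner_vec_def[of _ y] sum_UNIV_option running_cost_grad_def inner_add_left sum.distrib)
qed

lemma running_cost_grad_sym: "running_cost_grad x \<bullet> y = running_cost_grad y \<bullet> x"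
  unfolding running_cost_grad_inner by (simp add: inner_commute)

lemma running_cost_eq: "running_cost \<nu> x u = (running_cost_grad x \<bullet> x) / 2 + \<nu> / 2 * (u \<bullet> u)"
  unfolding running_cost_grad_inner running_cost_def by (simp add: power2_norm_eq_inner add_divide_distrib)

text \<open>The cost is a homogeneous quadratic form in (x,u), so the expansion is exact and its
  second-order coefficient is the cost of the variation itself.\<close>

lemma running_cost_expand:
  "running_cost \<nu> (x + s *\<^sub>R y) (u + s *\<^sub>R w) =
    running_cost \<nu> x u + s * (running_cost_grad x \<bullet> y + \<nu> * (u \<bullet> w)) + s\<^sup>2 * running_cost \<nu> y w"
  unfolding running_cost_eq
  using running_cost_grad_sym[of y x]
  by (simp add: linear_simps(1,5)[OF bounded_linear_running_cost_grad] inner_add_left inner_add_right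
      inner_commute[of w u] power2_eq_square field_simps)

lemma GDERIV_running_cost: "GDERIV (\<lambda>y. running_cost \<nu> y u) x :> running_cost_grad x"
proof -
  have e: "(running_cost_grad x \<bullet> h + running_cost_grad h \<bullet> x) / 2 = h \<bullet> running_cost_grad x" for h
    using running_cost_grad_sym[of h x] inner_commute[of h "running_cost_grad x"] by simp
  have "((\<lambda>y. running_cost \<nu> y u) has_derivative
      (\<lambda>h. (running_cost_grad x \<bullet> h + running_cost_grad h \<bullet> x) / 2)) (at x)"
    unfolding running_cost_eq
    by (auto intro!: derivative_eq_intros bounded_linear.has_derivative[OF bounded_linear_running_cost_grad])
  then show ?thesis unfolding gderiv_def e .
qed

section \<open>The maximum principle\<close>

text \<open>Under time reversal the backward equation becomes a forward one of the type already
  solved.\<close>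

lemma frac_adjoint_solution:
  fixes A :: "'a::euclidean_space \<Rightarrow> 'a"
  assumes a: "1/2 < \<alpha>" and T: "0 < T" and A: "bounded_linear A" and F: "borel_L2 T F"
  obtains g where "borel_L2 T g" "\<And>t. t \<in> {0..T} \<Longrightarrow> g t = F t + A (frac_int_right T \<alpha> g t)"
proof -
  obtain h where h: "borel_L2 T h" "\<And>t. t \<in> {0..T} \<Longrightarrow> h t = F (T - t) + A (frac_int \<alpha> h t)"
    using frac_volterra_solution[OF a T A borel_L2_reflect[OF F]] by metis
  have "h (T - t) = F t + A (frac_int_right T \<alpha> (\<lambda>t. h (T - t)) t)" if "t \<in> {0..T}" for t
    using h(2)[of "T - t"] that by (simp add: frac_int_right_def)
  then show ?thesis using that borel_L2_reflect[OF h(1)] by blast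
qed

lemma running_cost_integrable:
  assumes x: "L2_on T x" and u: "L2_on T u"
  shows "integrable (lebesgue_on {0..T}) (\<lambda>t. running_cost \<nu> (x t) (u t))"
  unfolding running_cost_eq
  by (intro Bochner_Integration.integrable_add integrable_divide integrable_mult_right
      L2_inner_integrable L2_on_linear[OF x bounded_linear_running_cost_grad] x u)

lemma L2_on_controls:
  assumes "u \<in> controls T K"
  shows "L2_on T u"
  using assms by (intro L2_on_bounded[where B = K]) (auto simp: controls_def L1_on_def control_values_def)

lemma total_cost_expand:
  assumes x: "L2_on T x" and u: "L2_on T u" and y: "L2_on T y" and w: "L2_on T w"
  shows "total_cost T \<nu> (\<lambda>t. x t + s *\<^sub>R y t) (\<lambda>t. u t + s *\<^sub>R w t) =
    total_cost T \<nu> x u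
    + s * (LINT t|lebesgue_on {0..T}. running_cost_grad (x t) \<bullet> y t + \<nu> * (u t \<bullet> w t))
    + s\<^sup>2 * total_cost T \<nu> y w"
proof -
  have "integrable (lebesgue_on {0..T}) (\<lambda>t. running_cost_grad (x t) \<bullet> y t + \<nu> * (u t \<bullet> w t))"
    by (intro Bochner_Integration.integrable_add integrable_mult_right
      L2_inner_integrable L2_on_linear[OF x bounded_linear_running_cost_grad] y u w)
  then show ?thesis unfolding total_cost_def running_cost_expand
    using running_cost_integrable[OF x u, of \<nu>] running_cost_integrable[OF y w, of \<nu>] by simp
qed

text \<open>\<open>v - us\<close> is only Lebesgue measurable; its Borel representative \<open>w\<close> drives the variation of
  the state.\<close>

lemma first_variation_nonneg:
  fixes xs :: "real \<Rightarrow> ('d::finite, 'n::finite) state"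
  assumes a: "1/2 < \<alpha>" "\<alpha> < 1" and T: "0 < T"
    and opt: "locally_optimal T \<alpha> \<nu> K a c x0 xs us" and v: "v \<in> controls T K"
    and w: "borel_L2 T w" "AE t in lebesgue_on {0..T}. v t - us t = w t"
    and h: "borel_L2 T h" "\<And>t. t \<in> {0..T} \<Longrightarrow> h t = leader (w t) + dynamics a c (frac_int \<alpha> h t) 0"
  shows "0 \<le> (LINT t|lebesgue_on {0..T}. running_cost_grad (xs t) \<bullet> frac_int \<alpha> h t + \<nu> * (us t \<bullet> (v t - us t)))"
proof -
  have us: "us \<in> controls T K" using opt by (simp add: locally_optimal_def)
  obtain g x1 where xs: "X_rep T \<alpha> xs g x1"
    using opt X_space_obtain_rep unfolding locally_optimal_def by metis
  have sys: "AE t in lebesgue_on {0..T}. g t = dynamics a c (xs t) (us t)" "Gamma \<alpha> *\<^sub>R x1 = x0"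
    using opt satisfies_system_rep[OF a T xs] by (auto simp: locally_optimal_def)
  obtain V \<epsilon> where V: "0 < \<epsilon>" "{y \<in> X_space T \<alpha>. X_norm T \<alpha> (\<lambda>t. y t - xs t) < \<epsilon>} \<subseteq> V"
    "\<And>x u. x \<in> V \<Longrightarrow> u \<in> controls T K \<Longrightarrow> satisfies_system T \<alpha> a c x0 x u \<Longrightarrow> total_cost T \<nu> xs us \<le> total_cost T \<nu> x u"
    using opt unfolding locally_optimal_def X_nbhd_def by blast
  \<comment> \<open>Singular coefficient 0 means zero initial value: the varied state keeps the
    prescribed initial data.\<close>
  have y: "X_rep T \<alpha> (frac_int \<alpha> h) h 0" using h(1) by (simp add: X_rep_def)
  note xsL = X_rep_L2_on[OF a xs] and usL = L2_on_controls[OF us] and yL = X_rep_L2_on[OF a y]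
  have dL: "L2_on T (\<lambda>t. v t - us t)" by (rule L2_on_cong_AE[OF borel_L2_imp_L2_on[OF w(1)] w(2)])
  define L where "L = (LINT t|lebesgue_on {0..T}. running_cost_grad (xs t) \<bullet> frac_int \<alpha> h t + \<nu> * (us t \<bullet> (v t - us t)))"
  define Q where "Q = total_cost T \<nu> (frac_int \<alpha> h) (\<lambda>t. v t - us t)"
  define H where "H = L2_norm_on T h"
  have H0: "0 \<le> H" unfolding H_def L2_norm_on_def by (intro real_sqrt_ge_zero integral_nonneg_AE) auto
  \<comment> \<open>The bound s <= 1 keeps the control in the ball by convexity, and
    \<open>s * H < \<epsilon>\<close> keeps the state in the neighbourhood, since
    \<open>s * H\<close> is the X-distance.\<close>
  have main: "0 \<le> s * L + s\<^sup>2 * Q" if s: "0 < s" "s \<le> 1" "s * H < \<epsilon>" for s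
  proof -
    let ?x = "\<lambda>t. xs t + s *\<^sub>R frac_int \<alpha> h t" and ?u = "\<lambda>t. us t + s *\<^sub>R (v t - us t)"
    have sy: "X_rep T \<alpha> (\<lambda>t. s *\<^sub>R frac_int \<alpha> h t) (\<lambda>t. s *\<^sub>R h t) 0"
      using X_rep_linear[OF a(1) y bounded_linear_scaleR_right[of s]] by simp
    have x: "X_rep T \<alpha> ?x (\<lambda>t. g t + s *\<^sub>R h t) x1" using X_rep_add[OF a(1) xs sy] by simp
    have "X_norm T \<alpha> (\<lambda>t. ?x t - xs t) = L2_norm_on T (\<lambda>t. s *\<^sub>R h t)"
      using X_norm_rep[OF a T sy] by simp
    also have "\<dots> = s * H"
      using s(1) by (simp add: L2_norm_on_def H_def power_mult_distrib real_sqrt_mult)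
    finally have xV: "?x \<in> V" using V(2) X_rep_in_X_space[OF x] s(3) by auto
    have u: "?u \<in> controls T K"
    proof -
      have "integrable (lebesgue_on {0..T}) ?u" using us v by (auto simp: controls_def L1_on_def)
      moreover have "norm (?u t) \<le> K" if "t \<in> {0..T}" for t
      proof -
        have "?u t = (1 - s) *\<^sub>R us t + s *\<^sub>R v t" by (simp add: algebra_simps)
        then have "norm (?u t) \<le> (1 - s) * norm (us t) + s * norm (v t)"
          using s norm_triangle_ineq[of "(1 - s) *\<^sub>R us t" "s *\<^sub>R v t"] by simp
        also have "\<dots> \<le> (1 - s) * K + s * K"
          using us v that s by (intro add_mono mult_left_mono) (auto simp: controls_def control_values_def)
        finally show ?thesis by (simp add: algebra_simps)
      qed
      ultimately show ?thesis by (simp add: controls_def L1_on_def control_values_def)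
    qed
    have "AE t in lebesgue_on {0..T}. g t + s *\<^sub>R h t = dynamics a c (?x t) (?u t)"
      using sys(1) w(2) unfolding AE_lebesgue_on_iff
    proof eventually_elim
      case (elim t)
      show ?case
      proof
        assume t: "t \<in> {0..T}"
        have "dynamics a c (?x t) (?u t) = dynamics a c (xs t) (us t) + s *\<^sub>R (leader (w t) + dynamics a c (frac_int \<alpha> h t) 0)"
          using elim t dynamics_split[of a c "xs t" "us t"] dynamics_split[of a c "?x t" "?u t"]
          by (simp add: linear_simps(1,5)[OF bounded_linear_dynamics] linear_simps(1,5)[OF bounded_linear_leader] scaleR_add_right)
        then show "g t + s *\<^sub>R h t = dynamics a c (?x t) (?u t)" using elim t h(2)[OF t] by simp
      qed
    qed
    then have "satisfies_system T \<alpha> a c x0 ?x ?u" using satisfies_system_rep[OF a T x] sys(2) by simp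
    then have "total_cost T \<nu> xs us \<le> total_cost T \<nu> ?x ?u" by (rule V(3)[OF xV u])
    then show ?thesis
      unfolding total_cost_expand[OF xsL usL yL dL] L_def Q_def by simp
  qed
  have "0 \<le> L"
  proof (rule ccontr)
    assume "\<not> 0 \<le> L"
    then have L: "L < 0" by simp
    \<comment> \<open>The three bounds serve admissibility of the control, closeness of the state,
      and s |Q| < -L, which contradicts the inequality divided by s. Adding 1 to \<open>H\<close>
      and \<open>\<bar>Q\<bar>\<close> keeps the denominators positive.\<close>
    define s where "s = min 1 (min (\<epsilon> / (2 * (H + 1))) (- L / (2 * (\<bar>Q\<bar> + 1))))"
    have "0 < \<epsilon> / (2 * (H + 1))" using V(1) H0 by (intro divide_pos_pos) auto
    moreover have "0 < - L / (2 * (\<bar>Q\<bar> + 1))" using L by (intro divide_pos_pos) auto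
    ultimately have s: "0 < s" "s \<le> 1" unfolding s_def by linarith+
    have "s * (2 * (H + 1)) \<le> \<epsilon>" using H0 by (simp add: s_def pos_le_divide_eq[symmetric] min_le_iff_disj)
    moreover have "s * (2 * (H + 1)) = 2 * (s * H) + 2 * s" by (simp add: algebra_simps)
    moreover have "0 \<le> s * H" using s H0 by simp
    ultimately have "s * H < \<epsilon>" using s by linarith
    then have "0 \<le> s * (L + s * Q)" using main[OF s] by (simp add: power2_eq_square algebra_simps)
    then have "0 \<le> L + s * Q" using s by (simp add: zero_le_mult_iff)
    moreover have "s * (2 * (\<bar>Q\<bar> + 1)) \<le> - L" by (simp add: s_def pos_le_divide_eq[symmetric] min_le_iff_disj)
    moreover have "s * Q \<le> s * \<bar>Q\<bar>" using s by (intro mult_left_mono) auto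
    moreover have "0 \<le> s * \<bar>Q\<bar>" using s by simp
    moreover have "s * (2 * (\<bar>Q\<bar> + 1)) = 2 * (s * \<bar>Q\<bar>) + 2 * s" by (simp add: algebra_simps)
    ultimately show False using s by linarith
  qed
  then show ?thesis by (simp add: L_def)
qed

lemma lebesgue_on_integral_supported:
  fixes f :: "real \<Rightarrow> 'a::euclidean_space"
  assumes f: "f \<in> borel_measurable borel" "\<And>t. t \<notin> {a..b} \<Longrightarrow> f t = 0"
  shows "(LINT t|lebesgue_on {a..b}. f t) = (LINT t|lborel. f t)"
proof -
  have "(\<lambda>t. indicator {a..b} t *\<^sub>R f t) = f" using f(2) by (force simp: indicator_def)
  then show ?thesis using lebesgue_on_borel_integral[OF f(1), of a b] by simp
qed

theorem theorem4:
  fixes T \<alpha> \<nu> K :: real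
    and a :: "'n::finite \<Rightarrow> 'n \<Rightarrow> real"
    and c :: "'n \<Rightarrow> real"
    and x0 :: "('d::finite, 'n) state"
    and xs :: "real \<Rightarrow> ('d, 'n) state"
    and us :: "real \<Rightarrow> real ^ 'd"
  assumes "1 / 2 < \<alpha>" and "\<alpha> < 1"
    and "0 < T"
    and "CARD('n) > 1"
    and "\<And>i j. 0 \<le> a i j" and "\<And>i. 0 \<le> c i"
    and "0 < \<nu>" and "0 \<le> K"
    and "locally_optimal T \<alpha> \<nu> K a c x0 xs us"
  shows "(\<forall>(x :: ('d, 'n) state) u. GDERIV (\<lambda>y. running_cost \<nu> y u) x :> running_cost_grad x) \<and>
    (\<exists>lam :: real \<Rightarrow> ('d, 'n) state.
        lam \<in> RL_int_right_L2 T \<alpha> \<and>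
        RL_differentiable_right T \<alpha> lam \<and>
        (AE t in lebesgue_on {0..T}.
           RL_deriv_right T \<alpha> lam t =
             block_mult_vec (block_transpose (system_matrix a c)) (lam t) + running_cost_grad (xs t)) \<and>
        RL_terminal_value T \<alpha> lam = 0 \<and>
        (AE t in lebesgue_on {0..T}.
           is_minimum
             (running_cost \<nu> (xs t) (us t) + lam t \<bullet> dynamics a c (xs t) (us t))
             ((\<lambda>u. running_cost \<nu> (xs t) u + lam t \<bullet> dynamics a c (xs t) u) ` control_values K)))"
proof -
  note \<alpha> = assms(1,2) and T = assms(3) and \<nu> = assms(7) and K = assms(8) and opt = assms(9)
  let ?G = "running_cost_grad :: ('d, 'n) state \<Rightarrow> _"
  let ?At = "block_mult_vec (block_transpose (system_matrix a c)) :: ('d, 'n) state \<Rightarrow> _"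
  have us: "us \<in> controls T K" using opt by (simp add: locally_optimal_def)
  obtain gx x1 where xs: "X_rep T \<alpha> xs gx x1"
    using opt X_space_obtain_rep unfolding locally_optimal_def by metis
  note xsL = X_rep_L2_on[OF \<alpha> xs] and usL = L2_on_controls[OF us]
  obtain xb where xb: "borel_L2 T xb" "AE t in lebesgue_on {0..T}. xs t = xb t" using borel_L2_rep[OF xsL] .
  note F = borel_L2_linear[OF xb(1) bounded_linear_running_cost_grad]
  \<comment> \<open>The unknown is the derivative of \<lambda>, so that \<lambda> = I^\<alpha>_{T-}
    g lies in the required class by construction. The Borel version \<open>xb\<close> replaces
    \<open>xs\<close> in the source term.\<close>
  obtain g where g: "borel_L2 T g" "\<And>t. t \<in> {0..T} \<Longrightarrow> g t = ?G (xb t) + ?At (frac_int_right T \<alpha> g t)"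
    using frac_adjoint_solution[OF \<alpha>(1) T bounded_linear_block_mult_vec F] by metis
  define lam where "lam = frac_int_right T \<alpha> g"
  have R: "lam \<in> RL_int_right_L2 T \<alpha>" "RL_differentiable_right T \<alpha> lam"
    "AE t in lebesgue_on {0..T}. RL_deriv_right T \<alpha> lam t = g t" "RL_terminal_value T \<alpha> lam = 0"
    using RL_right_structure[OF \<alpha> T g(1), of lam] by (auto simp: lam_def)
  have D: "AE t in lebesgue_on {0..T}. RL_deriv_right T \<alpha> lam t = ?At (lam t) + ?G (xs t)"
    using R(3) xb(2) unfolding AE_lebesgue_on_iff
    by eventually_elim (use g(2) in \<open>simp add: lam_def\<close>)

  let ?l = "\<lambda>t. indicator {0..T} t *\<^sub>R lam t"
  have lB: "borel_L2 T ?l" unfolding lam_def by (rule borel_L2_truncated_frac_int_right[OF \<alpha>(1) g(1)])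
  have l0B: "borel_L2 T (\<lambda>t. ?l t $ None)" by (rule borel_L2_linear[OF lB bounded_linear_vec_nth])
  \<comment> \<open>On [0,T] this is the gradient in u of the Hamiltonian at \<open>us t\<close>;
    the truncation of \<lambda> makes it an L^2 function.\<close>
  define p where "p = (\<lambda>t. ?l t $ None + \<nu> *\<^sub>R us t)"
  have pL: "L2_on T p" unfolding p_def
    by (rule L2_on_add[OF borel_L2_imp_L2_on[OF l0B] L2_on_linear[OF usL bounded_linear_scaleR_right]])
  then have [measurable]: "p \<in> borel_measurable (lebesgue_on {0..T})" by (simp add: L2_on_def)
  \<comment> \<open>Minimises the inner product with \<open>p t\<close> over the ball of radius K,
    by a formula measurable in t. Where \<open>p t = 0\<close>, it gives 0, which is a minimiser as
    well.\<close>
  define v where "v = (\<lambda>t. (- (K / norm (p t))) *\<^sub>R p t)"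
  have vK: "norm (v t) \<le> K" for t using K by (simp add: v_def)
  have pv: "p t \<bullet> v t = - K * norm (p t)" for t
    by (simp add: v_def power2_norm_eq_inner[symmetric] power2_eq_square)
  have vm: "v \<in> borel_measurable (lebesgue_on {0..T})" unfolding v_def by measurable
  have vL: "L2_on T v" by (rule L2_on_bounded[OF vm vK])
  have "integrable (lebesgue_on {0..T}) v"
  proof (rule Bochner_Integration.integrable_bound[OF _ vm])
    show "integrable (lebesgue_on {0..T}) (\<lambda>t. K)"
      by (subst lebesgue_on_borel_integrable) (auto simp: emeasure_lborel_Icc_eq)
  qed (use vK K in auto)
  then have v: "v \<in> controls T K" using vK by (simp add: controls_def L1_on_def control_values_def)
  have dL: "L2_on T (\<lambda>t. v t - us t)"
    using L2_on_add[OF vL L2_on_linear[OF usL bounded_linear_scaleR_right[of "-1"]]] by simp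
  obtain w where w: "borel_L2 T w" "AE t in lebesgue_on {0..T}. v t - us t = w t" using borel_L2_rep[OF dL] .
  obtain h where h: "borel_L2 T h" "\<And>t. t \<in> {0..T} \<Longrightarrow> h t = leader (w t) + dynamics a c (frac_int \<alpha> h t) (0 :: real ^ 'd)"
    using frac_volterra_solution[OF \<alpha>(1) T bounded_linear_dynamics borel_L2_linear[OF w(1) bounded_linear_leader]] by metis
  note var = first_variation_nonneg[OF \<alpha> T opt v w h]

  let ?y = "\<lambda>t. indicator {0..T} t *\<^sub>R frac_int \<alpha> h t"
  let ?Z = "\<lambda>t. ?l t \<bullet> dynamics a c (?y t) 0"
  have yB: "borel_L2 T ?y" by (rule borel_L2_truncated_frac_int[OF \<alpha>(1) h(1)])
  have adj: "?At x \<bullet> y = x \<bullet> dynamics a c y 0" for x y :: "('d, 'n) state"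
    by (simp add: block_transpose_adjoint block_mult_vec_system_matrix)
  have iFy: "integrable lborel (\<lambda>t. ?G (xb t) \<bullet> ?y t)" by (rule borel_L2_inner_integrable[OF F yB])
  have iZ: "integrable lborel ?Z" by (rule borel_L2_inner_integrable[OF lB borel_L2_linear[OF yB bounded_linear_dynamics]])
  have ilw: "integrable lborel (\<lambda>t. ?l t $ None \<bullet> w t)" by (rule borel_L2_inner_integrable[OF l0B w(1)])
  \<comment> \<open>Inserting the adjoint equation for \<open>g\<close> and the linearised one for
    \<open>h\<close> into the duality produces the coupling term \<open>?Z\<close> on both sides. It
    cancels and leaves only the leader's component of \<lambda> paired with the control
    variation.\<close>
  have "(LINT t|lborel. ?G (xb t) \<bullet> ?y t) + (LINT t|lborel. ?Z t) = (LINT t|lborel. ?G (xb t) \<bullet> ?y t + ?Z t)"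
    by (rule Bochner_Integration.integral_add[OF iFy iZ, symmetric])
  also have "\<dots> = (LINT t|lborel. g t \<bullet> frac_int \<alpha> h t)"
  proof (intro Bochner_Integration.integral_cong refl)
    fix t
    show "?G (xb t) \<bullet> ?y t + ?Z t = g t \<bullet> frac_int \<alpha> h t"
    proof (cases "t \<in> {0..T}")
      case True
      then show ?thesis using g(2)[OF True] by (simp add: inner_add_left adj lam_def)
    qed (use borel_L2_support[OF g(1)] in simp)
  qed
  also have "\<dots> = (LINT t|lborel. lam t \<bullet> h t)"
    unfolding lam_def by (rule frac_int_duality[OF \<alpha>(1) g(1) h(1)])
  also have "\<dots> = (LINT t|lborel. ?l t $ None \<bullet> w t + ?Z t)"
  proof (intro Bochner_Integration.integral_cong refl)
    fix t
    show "lam t \<bullet> h t = ?l t $ None \<bullet> w t + ?Z t"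
    proof (cases "t \<in> {0..T}")
      case True
      then show ?thesis using h(2)[OF True] by (simp add: inner_add_right inner_leader)
    qed (use borel_L2_support[OF h(1)] in simp)
  qed
  also have "\<dots> = (LINT t|lborel. ?l t $ None \<bullet> w t) + (LINT t|lborel. ?Z t)"
    by (rule Bochner_Integration.integral_add[OF ilw iZ])
  finally have dual: "(LINT t|lborel. ?G (xb t) \<bullet> ?y t) = (LINT t|lborel. ?l t $ None \<bullet> w t)" by simp

  have yL: "L2_on T (frac_int \<alpha> h)"
    by (rule X_rep_L2_on[OF \<alpha>, of _ _ h 0]) (use h(1) in \<open>simp add: X_rep_def\<close>)
  note l0L = borel_L2_imp_L2_on[OF l0B] and GL = L2_on_linear[OF xsL bounded_linear_running_cost_grad]
  have "(LINT t|lebesgue_on {0..T}. ?G (xs t) \<bullet> frac_int \<alpha> h t) = (LINT t|lebesgue_on {0..T}. ?G (xb t) \<bullet> ?y t)"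
  proof (rule integral_cong_AE)
    show "AE t in lebesgue_on {0..T}. ?G (xs t) \<bullet> frac_int \<alpha> h t = ?G (xb t) \<bullet> ?y t"
      using xb(2) unfolding AE_lebesgue_on_iff by eventually_elim simp
  qed (intro borel_measurable_integrable L2_inner_integrable GL yL borel_L2_imp_L2_on[OF F] borel_L2_imp_L2_on[OF yB])+
  also have "\<dots> = (LINT t|lborel. ?G (xb t) \<bullet> ?y t)"
    by (rule lebesgue_on_integral_supported) (use borel_measurable_integrable[OF iFy] in auto)
  also have "\<dots> = (LINT t|lebesgue_on {0..T}. ?l t $ None \<bullet> w t)"
    unfolding dual by (rule lebesgue_on_integral_supported[symmetric]) (use borel_measurable_integrable[OF ilw] in auto)
  also have "\<dots> = (LINT t|lebesgue_on {0..T}. ?l t $ None \<bullet> (v t - us t))"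
  proof (rule integral_cong_AE)
    show "AE t in lebesgue_on {0..T}. ?l t $ None \<bullet> w t = ?l t $ None \<bullet> (v t - us t)"
      using w(2) by eventually_elim simp
  qed (intro borel_measurable_integrable L2_inner_integrable l0L dL borel_L2_imp_L2_on[OF w(1)])+
  finally have e: "(LINT t|lebesgue_on {0..T}. ?G (xs t) \<bullet> frac_int \<alpha> h t) = (LINT t|lebesgue_on {0..T}. ?l t $ None \<bullet> (v t - us t))" .
  have "(LINT t|lebesgue_on {0..T}. p t \<bullet> (v t - us t)) =
    (LINT t|lebesgue_on {0..T}. ?l t $ None \<bullet> (v t - us t) + \<nu> * (us t \<bullet> (v t - us t)))"
    by (simp add: p_def inner_add_left)
  also have "\<dots> = (LINT t|lebesgue_on {0..T}. ?G (xs t) \<bullet> frac_int \<alpha> h t + \<nu> * (us t \<bullet> (v t - us t)))"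
    using e L2_inner_integrable[OF l0L dL] L2_inner_integrable[OF GL yL] integrable_mult_right[OF L2_inner_integrable[OF usL dL], of \<nu>]
    by (subst (1 2) Bochner_Integration.integral_add) simp_all
  finally have "0 \<le> (LINT t|lebesgue_on {0..T}. p t \<bullet> (v t - us t))" using var by simp
  moreover have ip: "integrable (lebesgue_on {0..T}) (\<lambda>t. - (p t \<bullet> (v t - us t)))"
    using L2_inner_integrable[OF pL dL] by simp
  \<comment> \<open>By the choice of \<open>v\<close> the integrand has a sign opposite to the one
    that optimality gives to its integral; hence it vanishes almost everywhere, and
    \<open>us t\<close> attains the minimum that \<open>v t\<close> attains.\<close>
  moreover have nn: "0 \<le> - (p t \<bullet> (v t - us t))" if t: "t \<in> {0..T}" for t
  proof -
    have "- (p t \<bullet> us t) \<le> norm (p t) * norm (us t)" using norm_cauchy_schwarz[of "- p t" "us t"] by simp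
    also have "\<dots> \<le> norm (p t) * K" using us t by (intro mult_left_mono) (auto simp: controls_def control_values_def)
    finally show ?thesis by (simp add: inner_diff_right pv mult.commute)
  qed
  moreover have nnAE: "AE t in lebesgue_on {0..T}. 0 \<le> - (p t \<bullet> (v t - us t))"
    using nn by (simp add: AE_lebesgue_on_iff)
  moreover have "0 \<le> (LINT t|lebesgue_on {0..T}. - (p t \<bullet> (v t - us t)))" using nnAE by (rule integral_nonneg_AE)
  ultimately have "(LINT t|lebesgue_on {0..T}. - (p t \<bullet> (v t - us t))) = 0" by simp
  then have "AE t in lebesgue_on {0..T}. - (p t \<bullet> (v t - us t)) = 0"
    using integral_nonneg_eq_0_iff_AE[OF ip nnAE] by blast
  then have pmin: "AE t in lebesgue_on {0..T}. p t \<bullet> us t = - K * norm (p t)"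
    by eventually_elim (simp add: inner_diff_right pv)
  have "AE t in lebesgue_on {0..T}. is_minimum
             (running_cost \<nu> (xs t) (us t) + lam t \<bullet> dynamics a c (xs t) (us t))
             ((\<lambda>u. running_cost \<nu> (xs t) u + lam t \<bullet> dynamics a c (xs t) u) ` control_values K)"
    using pmin unfolding AE_lebesgue_on_iff
  proof eventually_elim
    case (elim t)
    show ?case
    proof
      assume t: "t \<in> {0..T}"
      have usK: "us t \<in> control_values K" using us t by (simp add: controls_def)
      have "running_cost \<nu> (xs t) (us t) + lam t \<bullet> dynamics a c (xs t) (us t) \<le>
        running_cost \<nu> (xs t) u + lam t \<bullet> dynamics a c (xs t) u" if u: "u \<in> control_values K" for u
      proof -
        have "- (p t \<bullet> u) \<le> norm (p t) * norm u" using norm_cauchy_schwarz[of "- p t" u] by simp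
        also have "\<dots> \<le> norm (p t) * K" using u by (intro mult_left_mono) (auto simp: control_values_def)
        finally have "p t \<bullet> us t \<le> p t \<bullet> u" using elim t by (simp add: mult.commute)
        moreover have "p t = lam t $ None + \<nu> *\<^sub>R us t" using t by (simp add: p_def)
        ultimately have A: "lam t $ None \<bullet> us t + \<nu> * (us t \<bullet> us t) \<le> lam t $ None \<bullet> u + \<nu> * (us t \<bullet> u)"
          by (simp add: inner_add_left)
        \<comment> \<open>Half of this square, added to the linear inequality \<open>A\<close>,
          gives the comparison of the quadratic Hamiltonians; the terms that depend on the state
          alone cancel.\<close>
        have "0 \<le> \<nu> * ((u - us t) \<bullet> (u - us t))" using \<nu> by simp
        also have "\<dots> = \<nu> * (u \<bullet> u) - 2 * (\<nu> * (us t \<bullet> u)) + \<nu> * (us t \<bullet> us t)"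
          by (simp add: inner_diff_left inner_diff_right inner_commute[of u "us t"] algebra_simps)
        finally have "lam t $ None \<bullet> us t + \<nu> / 2 * (us t \<bullet> us t) \<le> lam t $ None \<bullet> u + \<nu> / 2 * (u \<bullet> u)"
          using A by simp
        then show ?thesis
          unfolding running_cost_eq dynamics_split[of a c "xs t" u] dynamics_split[of a c "xs t" "us t"]
          by (simp add: inner_add_right inner_leader)
      qed
      then show "is_minimum (running_cost \<nu> (xs t) (us t) + lam t \<bullet> dynamics a c (xs t) (us t))
             ((\<lambda>u. running_cost \<nu> (xs t) u + lam t \<bullet> dynamics a c (xs t) u) ` control_values K)"
        using usK by (auto simp: is_minimum_def)
    qed
  qed
  with R(1,2,4) D show ?thesis by (intro conjI allI exI[of _ lam] GDERIV_running_cost)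
qed

end
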